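(* Let $u,w\in\mathcal{D}(E)$ and suppose that $M_wEM_u$, $f\mapsto wE(uf)$, is a bounded operator on $L^2(\Sigma)$. Let $S=S(E(|u|^2))$, $G=S(E(|w|^2))$ and $H=S(E(uw))$. If $S(E(u)E(w))=S\cap G=H$, then the operator $M_wEM_u$ on $L^2(\Sigma)$ is centered if and only if $|E(uw)|^2=E(|u|^2)E(|w|^2)$.
   Context: $(X,\Sigma,\mu)$ is a complete $\sigma$-finite measure space and $\mathcal{A}\subseteq\Sigma$ is a sub-$\sigma$-algebra such that $(X,\mathcal{A},\mu|_{\mathcal{A}})$ is $\sigma$-finite. $L^2(\Sigma)=L^2(X,\Sigma,\mu)$ (complex-valued functions). $L^0(\Sigma)$ is the space of a.e. classes of a.e. finite-valued $\Sigma$-measurable functions, and $L^0(\mathcal{A})$ is its analogue for $\mathcal{A}$. $E=E^{\mathcal{A}}$ is the conditional expectation with respect to $\mathcal{A}$: $E(f)$ is the unique $\mathcal{A}$-measurable function with $\int_A f\,d\mu=\int_A E(f)\,d\mu$ for $A\in\mathcal{A}$, for non-negative measurable $f$ and for $f\in L^2(\Sigma)$, and it extends in the usual way to $\mathcal{D}(E)=\{g\in L^0(\Sigma): E(|g|)\in L^0(\mathcal{A})\}$. $M_u$ denotes multiplication by $u$. The support of a measurable function $f$ is $S(f)=\{x\in X: f(x)\neq 0\}$. All equalities between functions or sets hold up to $\mu$-null sets. A bounded operator $A$ on a Hilbert space is centered if the family $\{A^{*n}A^n,\ A^kA^{*k}: n,k\ge 0\}$ is commutative. *)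

theory Defs
  imports "HOL-Probability.Probability"
begin

text \<open>
  Elements of the function spaces below are represented by everywhere defined functions;
  two functions represent the same element if they agree almost everywhere, and every
  identity between functions, sets or operators is accordingly stated up to null sets.
  The sub-sigma-algebra is given by a measure \<open>F\<close>, of which only the space and the
  measurable sets matter; the measure on it is the restriction of \<open>M\<close>.
\<close>

definition ae_equal :: "'a measure \<Rightarrow> ('a \<Rightarrow> 'b) \<Rightarrow> ('a \<Rightarrow> 'b) \<Rightarrow> bool" where
  "ae_equal M f g \<longleftrightarrow> (AE x in M. f x = g x)"

definition ae_equal_sets :: "'a measure \<Rightarrow> 'a set \<Rightarrow> 'a set \<Rightarrow> bool" where
  "ae_equal_sets M A B \<longleftrightarrow> (AE x in M. x \<in> A \<longleftrightarrow> x \<in> B)"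

definition supp_set :: "'a measure \<Rightarrow> ('a \<Rightarrow> 'b::zero) \<Rightarrow> 'a set" where
  "supp_set M f = {x \<in> space M. f x \<noteq> 0}"

subsection \<open>Conditional expectation of complex functions\<close>

text \<open>
  The conditional expectation of a non-negative function may take the value \<open>\<infinity>\<close>, so for
  such functions we use \<^const>\<open>nn_cond_exp\<close>.
\<close>

definition cond_exp_domain :: "'a measure \<Rightarrow> 'a measure \<Rightarrow> ('a \<Rightarrow> complex) set" where
  "cond_exp_domain M F =
     {g \<in> borel_measurable M. AE x in M. nn_cond_exp M F (\<lambda>y. ennreal (cmod (g y))) x < \<infinity>}"

definition complex_cond_exp ::
  "'a measure \<Rightarrow> 'a measure \<Rightarrow> ('a \<Rightarrow> complex) \<Rightarrow> 'a \<Rightarrow> complex" where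
  "complex_cond_exp M F g =
     (\<lambda>x. Complex (real_cond_exp M F (\<lambda>y. Re (g y)) x) (real_cond_exp M F (\<lambda>y. Im (g y)) x))"

definition nn_cond_exp_sq :: "'a measure \<Rightarrow> 'a measure \<Rightarrow> ('a \<Rightarrow> complex) \<Rightarrow> 'a \<Rightarrow> ennreal" where
  "nn_cond_exp_sq M F g = nn_cond_exp M F (\<lambda>x. ennreal ((cmod (g x))\<^sup>2))"

subsection \<open>Bounded operators on the complex Hilbert space of square-integrable functions\<close>

definition L2_space :: "'a measure \<Rightarrow> ('a \<Rightarrow> complex) set" where
  "L2_space M = {f \<in> borel_measurable M. integrable M (\<lambda>x. (cmod (f x))\<^sup>2)}"

definition L2_inner :: "'a measure \<Rightarrow> ('a \<Rightarrow> complex) \<Rightarrow> ('a \<Rightarrow> complex) \<Rightarrow> complex" where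
  "L2_inner M f g = (LINT x|M. f x * cnj (g x))"

definition L2_norm :: "'a measure \<Rightarrow> ('a \<Rightarrow> complex) \<Rightarrow> real" where
  "L2_norm M f = sqrt (LINT x|M. (cmod (f x))\<^sup>2)"

definition L2_bounded_operator ::
  "'a measure \<Rightarrow> (('a \<Rightarrow> complex) \<Rightarrow> 'a \<Rightarrow> complex) \<Rightarrow> bool" where
  "L2_bounded_operator M T \<longleftrightarrow>
     (\<forall>f\<in>L2_space M. T f \<in> L2_space M) \<and>
     (\<forall>f\<in>L2_space M. \<forall>g\<in>L2_space M. ae_equal M f g \<longrightarrow> ae_equal M (T f) (T g)) \<and>
     (\<forall>f\<in>L2_space M. \<forall>g\<in>L2_space M. \<forall>a b.
        ae_equal M (T (\<lambda>x. a * f x + b * g x)) (\<lambda>x. a * T f x + b * T g x)) \<and>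
     (\<exists>C. \<forall>f\<in>L2_space M. L2_norm M (T f) \<le> C * L2_norm M f)"

text \<open>
  Every bounded operator has an adjoint, and it is unique up to null sets; the choice made
  here is therefore only one of a representative.
\<close>

definition L2_adjoint ::
  "'a measure \<Rightarrow> (('a \<Rightarrow> complex) \<Rightarrow> 'a \<Rightarrow> complex) \<Rightarrow> ('a \<Rightarrow> complex) \<Rightarrow> 'a \<Rightarrow> complex" where
  "L2_adjoint M T =
     (SOME T'. L2_bounded_operator M T' \<and>
        (\<forall>f\<in>L2_space M. \<forall>g\<in>L2_space M. L2_inner M (T f) g = L2_inner M f (T' g)))"

definition L2_centered ::
  "'a measure \<Rightarrow> (('a \<Rightarrow> complex) \<Rightarrow> 'a \<Rightarrow> complex) \<Rightarrow> bool" where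
  "L2_centered M T \<longleftrightarrow>
     L2_bounded_operator M T \<and>
     (let T' = L2_adjoint M T;
          family = range (\<lambda>n::nat. (T' ^^ n) \<circ> (T ^^ n)) \<union> range (\<lambda>k::nat. (T ^^ k) \<circ> (T' ^^ k))
      in \<forall>P\<in>family. \<forall>Q\<in>family. \<forall>f\<in>L2_space M. ae_equal M (P (Q f)) (Q (P f)))"

subsection \<open>Weighted conditional type operators\<close>

definition weighted_cond_op ::
  "'a measure \<Rightarrow> 'a measure \<Rightarrow> ('a \<Rightarrow> complex) \<Rightarrow> ('a \<Rightarrow> complex) \<Rightarrow>
     ('a \<Rightarrow> complex) \<Rightarrow> 'a \<Rightarrow> complex" where
  "weighted_cond_op M F w u f = (\<lambda>x. w x * complex_cond_exp M F (\<lambda>y. u y * f y) x)"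

text \<open>
  \<^const>\<open>complex_cond_exp\<close> is total, so it has to be said explicitly that the operator
  is defined on the whole space.
\<close>

definition bounded_weighted_cond_op ::
  "'a measure \<Rightarrow> 'a measure \<Rightarrow> ('a \<Rightarrow> complex) \<Rightarrow> ('a \<Rightarrow> complex) \<Rightarrow> bool" where
  "bounded_weighted_cond_op M F w u \<longleftrightarrow>
     (\<forall>f\<in>L2_space M. (\<lambda>x. u x * f x) \<in> cond_exp_domain M F) \<and>
     L2_bounded_operator M (weighted_cond_op M F w u)"

end

theory Submission
  imports Defs
begin

text \<open>
  Write \<open>T f = w E(u f)\<close>, \<open>q = E(u w)\<close>, \<open>a = E|u|\<^sup>2\<close> and \<open>b = E|w|\<^sup>2\<close>.

  A factor that is measurable for the subalgebra can be pulled out of \<open>E\<close>.  Hence the operators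
  \<open>f \<mapsto> \<phi> p E(r f)\<close> with such a factor \<open>\<phi>\<close> are closed under composition: applying the one
  given by \<open>\<phi>', p', r'\<close> first and then the one given by \<open>\<phi>, p, r\<close> yields the one given by
  \<open>\<phi> \<phi>' E(r p'), p, r'\<close>.  The adjoint of \<open>T\<close> is \<open>g \<mapsto> cnj u E(cnj w g)\<close>, and therefore, for
  \<open>n, m \<ge> 0\<close>, the operators formed from the powers of order \<open>n + 1\<close> and \<open>m + 1\<close> are

  \<^item> adjoint power after power: \<open>|q|\<^bsup>2n\<^esup> b cnj u E(u f)\<close>,
  \<^item> power after adjoint power: \<open>|q|\<^bsup>2m\<^esup> a w E(cnj w f)\<close>.

  Two operators of the same kind commute because their scalar factors do.  Two of different kinds
  commute if and only if \<open>|q|\<^bsup>2(n+m)\<^esup> a b (q cnj u E(cnj w f) - cnj q w E(u f))\<close> vanishes for all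
  \<open>f\<close>.  By the Cauchy-Schwarz inequality \<open>|q|\<^sup>2 \<le> a b\<close> the scalar in front is nonzero where \<open>q\<close> is
  (if \<open>n = m = 0\<close>), and where \<open>q = 0\<close> the bracket is zero.  So \<open>T\<close> is centered if and only if

  \<^item> \<open>q cnj u E(cnj w f) = cnj q w E(u f)\<close> for all square-integrable \<open>f\<close>  (*)

  and this is equivalent to equality in Cauchy-Schwarz on the support of \<open>q\<close>.  Indeed, inserting
  \<open>f = \<psi> cnj u\<close> with a positive weight \<open>\<psi>\<close> that is measurable for the subalgebra gives
  \<open>q cnj u = a w\<close> where \<open>q \<noteq> 0\<close>, and multiplying by \<open>cnj w\<close> and applying \<open>E\<close> gives
  \<open>|q|\<^sup>2 = a b\<close> there.  Conversely, where \<open>|q|\<^sup>2 = a b \<noteq> 0\<close> one finds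
  \<open>E|u - (q / b) cnj w|\<^sup>2 = 0\<close>, so that \<open>u\<close> is \<open>q / b\<close> times \<open>cnj w\<close>, and (*) is immediate.  These
  steps are \<open>represented_by_comp\<close>, \<open>cond_collinear\<close>, \<open>intertwining_iff\<close> and \<open>centered_iff\<close>.
  Off the support of \<open>q\<close>, the hypothesis that \<open>q\<close> and \<open>a b\<close> have the same support makes both
  sides of \<open>|q|\<^sup>2 = a b\<close> zero.

  These computations need \<open>a\<close> and \<open>b\<close> to be finite and \<open>a b\<close> to be bounded.  Testing the
  boundedness of \<open>T\<close> on weighted truncations of \<open>cnj u\<close> shows that \<open>a b\<close> is bounded, with the
  convention \<open>0 \<infinity> = 0\<close> (\<open>bounded_imp_moment_product_le\<close>).  Consequently \<open>a\<close> is finite where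
  \<open>b \<noteq> 0\<close> and vice versa, and replacing \<open>u\<close> by zero where \<open>b = 0\<close>, and \<open>w\<close> by zero where
  \<open>a = 0\<close>, changes none of \<open>T\<close>, \<open>q\<close> and \<open>a b\<close>.
\<close>

section \<open>Conditional expectation beyond integrable functions\<close>

context sigma_finite_subalgebra
begin

abbreviation "NE \<equiv> nn_cond_exp M F"
abbreviation "CE \<equiv> complex_cond_exp M F"

lemma measurable_lift: "f \<in> measurable F N \<Longrightarrow> f \<in> measurable M N"
  by (rule measurable_from_subalg[OF subalg])

lemma nn_integral_nn_cond_exp:
  assumes "f \<in> borel_measurable M"
  shows "(\<integral>\<^sup>+x. NE f x \<partial>M) = (\<integral>\<^sup>+x. f x \<partial>M)"
  using nn_cond_exp_intg[of "\<lambda>_. 1" f] assms by simp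

text \<open>
  The set where the conditional expectation vanishes belongs to the subalgebra, so \<open>f\<close> has the same
  integral over it as its conditional expectation, namely zero.
\<close>

lemma nn_cond_exp_eq_0_imp_zero:
  assumes [measurable]: "f \<in> borel_measurable M"
  shows "AE x in M. NE f x = 0 \<longrightarrow> f x = 0"
proof -
  let ?A = "{x \<in> space F. NE f x = 0}"
  have A[measurable]: "?A \<in> sets F"
    by measurable
  have [measurable]: "?A \<in> sets M"
    using A subalg by (auto simp: subalgebra_def)
  have "(\<integral>\<^sup>+x. indicator ?A x * f x \<partial>M) = (\<integral>\<^sup>+x. indicator ?A x * NE f x \<partial>M)"
    by (rule nn_cond_exp_intg[symmetric]) auto
  also have "\<dots> = (\<integral>\<^sup>+x. 0 \<partial>M)"
    by (intro nn_integral_cong) (auto simp: indicator_def)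
  finally have "AE x in M. indicator ?A x * f x = 0"
    by (simp add: nn_integral_0_iff_AE)
  moreover have "AE x in M. x \<in> space F"
    using subalg by (simp add: subalgebra_def)
  ultimately show ?thesis
    by eventually_elim (auto simp: indicator_def)
qed

text \<open>
  Conditional monotone convergence: on each set of the subalgebra the integrals agree, by ordinary
  monotone convergence on both sides.
\<close>

lemma nn_cond_exp_SUP:
  fixes f :: "nat \<Rightarrow> 'a \<Rightarrow> ennreal"
  assumes [measurable]: "\<And>n. f n \<in> borel_measurable M" and inc: "incseq f"
  shows "AE x in M. NE (\<lambda>x. SUP n. f n x) x = (SUP n. NE (f n) x)"
proof -
  have "AE x in M. \<forall>n. NE (f n) x \<le> NE (f (Suc n)) x"
    unfolding AE_all_countable
    by (intro allI nn_cond_exp_mono) (auto intro!: AE_I2 le_funD[OF incseq_SucD[OF inc]])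
  then have inc': "AE x in M. indicator A x * NE (f n) x \<le> indicator A x * NE (f (Suc n)) x" for A n
    by eventually_elim (auto intro: mult_left_mono)
  have "AE x in M. (SUP n. NE (f n) x) = NE (\<lambda>x. SUP n. f n x) x"
  proof (rule nn_cond_exp_charact)
    fix A assume A[measurable]: "A \<in> sets F"
    then have [measurable]: "A \<in> sets M" using subalg by (auto simp: subalgebra_def)
    have "(\<integral>\<^sup>+x\<in>A. (SUP n. f n x) \<partial>M) = (\<integral>\<^sup>+x. (SUP n. indicator A x * f n x) \<partial>M)"
      by (intro nn_integral_cong) (simp add: SUP_mult_left_ennreal mult.commute)
    also have "\<dots> = (SUP n. \<integral>\<^sup>+x. indicator A x * f n x \<partial>M)"
      by (intro nn_integral_monotone_convergence_SUP)
         (auto intro!: incseq_SucI le_funI mult_left_mono le_funD[OF incseq_SucD[OF inc]])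
    also have "\<dots> = (SUP n. \<integral>\<^sup>+x. indicator A x * NE (f n) x \<partial>M)"
      by (simp add: nn_cond_exp_intg)
    also have "\<dots> = (\<integral>\<^sup>+x. (SUP n. indicator A x * NE (f n) x) \<partial>M)"
      using inc' by (intro nn_integral_monotone_convergence_SUP_AE[symmetric]) auto
    also have "\<dots> = (\<integral>\<^sup>+x\<in>A. (SUP n. NE (f n) x) \<partial>M)"
      by (intro nn_integral_cong) (simp add: SUP_mult_left_ennreal mult.commute)
    finally show "(\<integral>\<^sup>+x\<in>A. (SUP n. f n x) \<partial>M) = (\<integral>\<^sup>+x\<in>A. (SUP n. NE (f n) x) \<partial>M)" .
  qed auto
  then show ?thesis by eventually_elim simp
qed

text \<open>
  If \<open>f\<close> is square-integrable and \<open>u\<close> merely measurable, \<open>u f\<close> need not be integrable even if the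
  conditional expectation of its modulus is finite.  The rules of calculation are therefore derived
  under this weaker condition, by rearranging identities between nonnegative functions; finiteness
  excludes \<open>\<infinity> - \<infinity>\<close>.
\<close>

lemma real_cond_exp_add_finite:
  fixes f g :: "'a \<Rightarrow> real"
  assumes [measurable]: "f \<in> borel_measurable M" "g \<in> borel_measurable M"
    and fin: "AE x in M. NE (\<lambda>x. \<bar>f x\<bar>) x < \<infinity>" "AE x in M. NE (\<lambda>x. \<bar>g x\<bar>) x < \<infinity>"
  shows "AE x in M. real_cond_exp M F (\<lambda>x. f x + g x) x
    = real_cond_exp M F f x + real_cond_exp M F g x"
proof -
  let ?s = "\<lambda>x. f x + g x"
  have parts: "AE x in M. NE (\<lambda>x. ennreal (h x)) x + NE (\<lambda>x. ennreal (- h x)) x = NE (\<lambda>x. \<bar>h x\<bar>) x"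
    if [measurable]: "h \<in> borel_measurable M" for h :: "'a \<Rightarrow> real"
  proof -
    have "(\<lambda>x. ennreal \<bar>h x\<bar>) = (\<lambda>x. ennreal (h x) + ennreal (- h x))"
      by (auto simp: abs_real_def ennreal_neg)
    then show ?thesis
      using nn_cond_exp_sum[of "\<lambda>x. ennreal (h x)" "\<lambda>x. ennreal (- h x)"] by simp
  qed
  have "AE x in M. NE (\<lambda>x. \<bar>?s x\<bar>) x \<le> NE (\<lambda>x. ennreal \<bar>f x\<bar> + ennreal \<bar>g x\<bar>) x"
    by (intro nn_cond_exp_mono) (auto simp: ennreal_plus[symmetric] simp del: ennreal_plus)
  moreover have "AE x in M. NE (\<lambda>x. ennreal \<bar>f x\<bar>) x + NE (\<lambda>x. ennreal \<bar>g x\<bar>) x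
      = NE (\<lambda>x. ennreal \<bar>f x\<bar> + ennreal \<bar>g x\<bar>) x"
    by (intro nn_cond_exp_sum) auto
  ultimately have fin_s: "AE x in M. NE (\<lambda>x. \<bar>?s x\<bar>) x < \<infinity>"
    using fin
  proof eventually_elim
    case (elim x)
    then have "NE (\<lambda>x. ennreal \<bar>f x\<bar> + ennreal \<bar>g x\<bar>) x < \<infinity>"
      by (metis ennreal_add_less_top infinity_ennreal_def)
    with elim(1) show ?case by (rule order.strict_trans1)
  qed
  \<comment> \<open>Both sides of this identity have finite conditional expectation, so it may be rearranged
    into one between differences.\<close>
  have bal: "(\<lambda>x. ennreal (?s x) + (ennreal (- f x) + ennreal (- g x)))
      = (\<lambda>x. ennreal (- ?s x) + (ennreal (f x) + ennreal (g x)))"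
  proof
    fix x
    show "ennreal (?s x) + (ennreal (- f x) + ennreal (- g x))
      = ennreal (- ?s x) + (ennreal (f x) + ennreal (g x))"
      by (cases "f x \<ge> 0"; cases "g x \<ge> 0"; cases "?s x \<ge> 0")
         (auto simp: ennreal_neg ennreal_plus[symmetric] simp del: ennreal_plus)
  qed
  have sum3: "AE x in M. NE (\<lambda>x. p x + (q x + r x)) x = NE p x + (NE q x + NE r x)"
    if [measurable]: "p \<in> borel_measurable M" "q \<in> borel_measurable M" "r \<in> borel_measurable M"
    for p q r :: "'a \<Rightarrow> ennreal"
    using nn_cond_exp_sum[of p "\<lambda>x. q x + r x"] nn_cond_exp_sum[of q r] by auto
  have "AE x in M. NE (\<lambda>x. ?s x) x + (NE (\<lambda>x. - f x) x + NE (\<lambda>x. - g x) x)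
      = NE (\<lambda>x. - ?s x) x + (NE (\<lambda>x. f x) x + NE (\<lambda>x. g x) x)"
    using sum3[of "\<lambda>x. ?s x" "\<lambda>x. - f x" "\<lambda>x. - g x"] sum3[of "\<lambda>x. - ?s x" "\<lambda>x. f x" "\<lambda>x. g x"]
    unfolding bal by auto
  with parts[OF assms(1)] parts[OF assms(2)] parts[OF borel_measurable_add[OF assms(1,2)]] fin fin_s show ?thesis
  proof eventually_elim
    case (elim x)
    have real_of: "enn2real a + (enn2real b + enn2real c) = enn2real a' + (enn2real b' + enn2real c')"
      if "a + (b + c) = a' + (b' + c')" "a < \<infinity>" "b < \<infinity>" "c < \<infinity>" "a' < \<infinity>" "b' < \<infinity>" "c' < \<infinity>"
      for a b c a' b' c' :: ennreal
      using arg_cong[OF that(1), of enn2real] that(2-) by (simp add: enn2real_plus)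
    have lt: "a < \<infinity>" "b < \<infinity>" if "a + b = c" "c < \<infinity>" for a b c :: ennreal
      using that by (auto simp: less_top)
    show ?case
      using real_of[OF elim(7)] lt[OF elim(1,4)] lt[OF elim(2,5)] lt[OF elim(3,6)]
      unfolding real_cond_exp_def by simp
  qed
qed

text \<open>
  The positive part of \<open>h f\<close> is \<open>h\<^sup>+ f\<^sup>+ + h\<^sup>- f\<^sup>-\<close>, and that of \<open>h (- f)\<close> is the negative part, so
  homogeneity reduces to that for nonnegative functions.
\<close>

lemma real_cond_exp_mult_finite:
  fixes f h :: "'a \<Rightarrow> real"
  assumes [measurable]: "f \<in> borel_measurable M" and h[measurable]: "h \<in> borel_measurable F"
    and fin: "AE x in M. NE (\<lambda>x. \<bar>f x\<bar>) x < \<infinity>"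
  shows "AE x in M. real_cond_exp M F (\<lambda>x. h x * f x) x = h x * real_cond_exp M F f x"
proof -
  have hM[measurable]: "h \<in> borel_measurable M" by (rule measurable_lift[OF h])
  have parts: "AE x in M. NE (\<lambda>x. ennreal (h x * g x)) x
      = ennreal (h x) * NE (\<lambda>x. ennreal (g x)) x + ennreal (- h x) * NE (\<lambda>x. ennreal (- g x)) x"
    if [measurable]: "g \<in> borel_measurable M" for g :: "'a \<Rightarrow> real"
  proof -
    have "(\<lambda>x. ennreal (h x * g x)) = (\<lambda>x. ennreal (h x) * ennreal (g x) + ennreal (- h x) * ennreal (- g x))"
    proof
      fix x
      show "ennreal (h x * g x) = ennreal (h x) * ennreal (g x) + ennreal (- h x) * ennreal (- g x)"
        by (cases "h x \<ge> 0"; cases "g x \<ge> 0")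
           (auto simp: ennreal_neg ennreal_mult[symmetric] mult_nonneg_nonpos mult_nonpos_nonneg)
    qed
    then show ?thesis
      using nn_cond_exp_sum[of "\<lambda>x. ennreal (h x) * ennreal (g x)" "\<lambda>x. ennreal (- h x) * ennreal (- g x)"]
        nn_cond_exp_prod[of "\<lambda>x. ennreal (h x)" "\<lambda>x. ennreal (g x)"]
        nn_cond_exp_prod[of "\<lambda>x. ennreal (- h x)" "\<lambda>x. ennreal (- g x)"]
      by auto
  qed
  have le: "AE x in M. NE (\<lambda>x. ennreal (f x)) x \<le> NE (\<lambda>x. \<bar>f x\<bar>) x"
    "AE x in M. NE (\<lambda>x. ennreal (- f x)) x \<le> NE (\<lambda>x. \<bar>f x\<bar>) x"
    by (intro nn_cond_exp_mono; auto intro!: ennreal_leI)+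
  have "AE x in M. NE (\<lambda>x. ennreal (h x * f x)) x
      = ennreal (h x) * NE (\<lambda>x. ennreal (f x)) x + ennreal (- h x) * NE (\<lambda>x. ennreal (- f x)) x"
    "AE x in M. NE (\<lambda>x. ennreal (- (h x * f x))) x
      = ennreal (h x) * NE (\<lambda>x. ennreal (- f x)) x + ennreal (- h x) * NE (\<lambda>x. ennreal (f x)) x"
    using parts[of f] parts[of "\<lambda>x. - f x"] by simp_all
  with fin le show ?thesis
  proof eventually_elim
    case (elim x)
    then have "NE (\<lambda>x. ennreal (f x)) x < \<infinity>" "NE (\<lambda>x. ennreal (- f x)) x < \<infinity>"
      by (auto intro: order.strict_trans1)
    with elim(4,5) show ?case
      unfolding real_cond_exp_def
      by (cases "h x \<ge> 0") (auto simp: ennreal_neg enn2real_mult algebra_simps)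
  qed
qed

section \<open>Conditional expectation of complex functions\<close>

lemma complex_cond_exp_measurable_F [measurable]: "CE f \<in> borel_measurable F"
  unfolding complex_cond_exp_def Complex_eq by measurable

lemma complex_cond_exp_measurable [measurable]: "CE f \<in> borel_measurable M"
  by (rule measurable_lift) measurable

lemma cond_exp_domain_measurable [measurable_dest]:
  "f \<in> cond_exp_domain M F \<Longrightarrow> f \<in> borel_measurable M"
  by (simp add: cond_exp_domain_def)

lemma cond_exp_domain_dominated:
  assumes [measurable]: "f \<in> borel_measurable M" "g \<in> borel_measurable M"
    and "AE x in M. ennreal (cmod (f x)) \<le> g x" "AE x in M. NE g x < \<infinity>"
  shows "f \<in> cond_exp_domain M F"
proof -
  have "AE x in M. NE (\<lambda>x. ennreal (cmod (f x))) x \<le> NE g x"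
    using assms by (intro nn_cond_exp_mono) auto
  with assms(4) have "AE x in M. NE (\<lambda>x. ennreal (cmod (f x))) x < \<infinity>"
    by eventually_elim (rule order.strict_trans1)
  then show ?thesis
    by (simp add: cond_exp_domain_def)
qed

lemma cond_exp_domain_Re_Im:
  assumes f: "f \<in> cond_exp_domain M F"
  shows "AE x in M. NE (\<lambda>x. \<bar>Re (f x)\<bar>) x < \<infinity>" "AE x in M. NE (\<lambda>x. \<bar>Im (f x)\<bar>) x < \<infinity>"
proof -
  note [measurable] = cond_exp_domain_measurable[OF f]
  have fin: "AE x in M. NE (\<lambda>x. ennreal (cmod (f x))) x < \<infinity>"
    using f by (simp add: cond_exp_domain_def)
  have finite_below: "AE x in M. p x < \<infinity>"
    if "AE x in M. q x < \<infinity>" "AE x in M. p x \<le> q x" for p q :: "'a \<Rightarrow> ennreal"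
    using that by eventually_elim (rule order.strict_trans1)
  have "AE x in M. NE (\<lambda>x. \<bar>Re (f x)\<bar>) x \<le> NE (\<lambda>x. ennreal (cmod (f x))) x"
    "AE x in M. NE (\<lambda>x. \<bar>Im (f x)\<bar>) x \<le> NE (\<lambda>x. ennreal (cmod (f x))) x"
    by (intro nn_cond_exp_mono; auto intro!: ennreal_leI abs_Re_le_cmod abs_Im_le_cmod)+
  with fin show "AE x in M. NE (\<lambda>x. \<bar>Re (f x)\<bar>) x < \<infinity>" "AE x in M. NE (\<lambda>x. \<bar>Im (f x)\<bar>) x < \<infinity>"
    by (blast intro: finite_below)+
qed

lemma cond_exp_domain_add:
  assumes f: "f \<in> cond_exp_domain M F" and g: "g \<in> cond_exp_domain M F"
  shows "(\<lambda>x. f x + g x) \<in> cond_exp_domain M F"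
proof (rule cond_exp_domain_dominated)
  note [measurable] = cond_exp_domain_measurable[OF f] cond_exp_domain_measurable[OF g]
  let ?b = "\<lambda>x. ennreal (cmod (f x)) + ennreal (cmod (g x))"
  show "(\<lambda>x. f x + g x) \<in> borel_measurable M" "?b \<in> borel_measurable M" by measurable
  show "AE x in M. ennreal (cmod (f x + g x)) \<le> ?b x"
    by (auto simp: norm_triangle_ineq ennreal_plus[symmetric] intro!: ennreal_leI simp del: ennreal_plus)
  have "AE x in M. NE (\<lambda>x. ennreal (cmod (f x))) x + NE (\<lambda>x. ennreal (cmod (g x))) x = NE ?b x"
    by (intro nn_cond_exp_sum) auto
  moreover have "AE x in M. NE (\<lambda>x. ennreal (cmod (f x))) x < \<infinity>"
    "AE x in M. NE (\<lambda>x. ennreal (cmod (g x))) x < \<infinity>"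
    using f g by (auto simp: cond_exp_domain_def)
  ultimately show "AE x in M. NE ?b x < \<infinity>"
    by eventually_elim (metis ennreal_add_less_top infinity_ennreal_def)
qed

lemma cond_exp_domain_mult:
  assumes h: "h \<in> borel_measurable F" and f: "f \<in> cond_exp_domain M F"
  shows "(\<lambda>x. h x * f x) \<in> cond_exp_domain M F"
proof (rule cond_exp_domain_dominated)
  note [measurable] = cond_exp_domain_measurable[OF f] h measurable_lift[OF h]
  let ?b = "\<lambda>x. ennreal (cmod (h x)) * ennreal (cmod (f x))"
  show "(\<lambda>x. h x * f x) \<in> borel_measurable M" "?b \<in> borel_measurable M" by measurable
  show "AE x in M. ennreal (cmod (h x * f x)) \<le> ?b x"
    by (simp add: norm_mult ennreal_mult)
  have "AE x in M. ennreal (cmod (h x)) * NE (\<lambda>x. ennreal (cmod (f x))) x = NE ?b x"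
    by (intro nn_cond_exp_prod) auto
  moreover have "AE x in M. NE (\<lambda>x. ennreal (cmod (f x))) x < \<infinity>"
    using f by (simp add: cond_exp_domain_def)
  ultimately show "AE x in M. NE ?b x < \<infinity>"
    by eventually_elim (metis ennreal_less_top ennreal_mult_less_top infinity_ennreal_def)
qed

lemma complex_cond_exp_cong:
  assumes "AE x in M. f x = g x" "f \<in> borel_measurable M" "g \<in> borel_measurable M"
  shows "AE x in M. CE f x = CE g x"
proof -
  note [measurable] = assms(2,3)
  have "AE x in M. real_cond_exp M F (\<lambda>y. Re (f y)) x = real_cond_exp M F (\<lambda>y. Re (g y)) x"
    "AE x in M. real_cond_exp M F (\<lambda>y. Im (f y)) x = real_cond_exp M F (\<lambda>y. Im (g y)) x"
    using assms(1) by (intro real_cond_exp_cong; force)+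
  then show ?thesis
    unfolding complex_cond_exp_def by eventually_elim simp
qed

lemma complex_cond_exp_cnj: "CE (\<lambda>x. cnj (f x)) = (\<lambda>x. cnj (CE f x))"
  by (simp add: complex_cond_exp_def real_cond_exp_def fun_eq_iff complex_eq_iff)

lemma complex_cond_exp_add:
  assumes f: "f \<in> cond_exp_domain M F" and g: "g \<in> cond_exp_domain M F"
  shows "AE x in M. CE (\<lambda>x. f x + g x) x = CE f x + CE g x"
proof -
  note [measurable] = cond_exp_domain_measurable[OF f] cond_exp_domain_measurable[OF g]
  have "AE x in M. real_cond_exp M F (\<lambda>x. Re (f x) + Re (g x)) x
      = real_cond_exp M F (\<lambda>x. Re (f x)) x + real_cond_exp M F (\<lambda>x. Re (g x)) x"
    "AE x in M. real_cond_exp M F (\<lambda>x. Im (f x) + Im (g x)) x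
      = real_cond_exp M F (\<lambda>x. Im (f x)) x + real_cond_exp M F (\<lambda>x. Im (g x)) x"
    using cond_exp_domain_Re_Im[OF f] cond_exp_domain_Re_Im[OF g]
    by (intro real_cond_exp_add_finite; simp)+
  then show ?thesis
    unfolding complex_cond_exp_def by eventually_elim (simp add: complex_eq_iff)
qed

lemma complex_cond_exp_mult:
  assumes h: "h \<in> borel_measurable F" and f: "f \<in> cond_exp_domain M F"
  shows "AE x in M. CE (\<lambda>x. h x * f x) x = h x * CE f x"
proof -
  note [measurable] = cond_exp_domain_measurable[OF f] h measurable_lift[OF h]
  have fin: "AE x in M. NE (\<lambda>x. \<bar>c x * g x\<bar>) x < \<infinity>"
    if "AE x in M. NE (\<lambda>x. \<bar>g x\<bar>) x < \<infinity>" and [measurable]: "c \<in> borel_measurable F" "g \<in> borel_measurable M"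
    for c g :: "'a \<Rightarrow> real"
  proof -
    have "AE x in M. ennreal \<bar>c x\<bar> * NE (\<lambda>x. ennreal \<bar>g x\<bar>) x = NE (\<lambda>x. ennreal \<bar>c x\<bar> * ennreal \<bar>g x\<bar>) x"
      by (intro nn_cond_exp_prod) auto
    with that(1) show ?thesis
      by eventually_elim
         (simp add: abs_mult ennreal_mult, metis ennreal_less_top ennreal_mult_less_top)
  qed
  have lin: "AE x in M. real_cond_exp M F (\<lambda>x. c x * a x + d x * b x) x
      = c x * real_cond_exp M F a x + d x * real_cond_exp M F b x"
    if [measurable]: "c \<in> borel_measurable F" "d \<in> borel_measurable F"
      "a \<in> borel_measurable M" "b \<in> borel_measurable M"
      and ab: "AE x in M. NE (\<lambda>x. \<bar>a x\<bar>) x < \<infinity>" "AE x in M. NE (\<lambda>x. \<bar>b x\<bar>) x < \<infinity>"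
    for a b c d :: "'a \<Rightarrow> real"
  proof -
    have [measurable]: "c \<in> borel_measurable M" "d \<in> borel_measurable M"
      using that by (auto intro: measurable_lift)
    show ?thesis
      using real_cond_exp_add_finite[of "\<lambda>x. c x * a x" "\<lambda>x. d x * b x"] fin[OF ab(1), of c] fin[OF ab(2), of d]
        real_cond_exp_mult_finite[of a c] real_cond_exp_mult_finite[of b d] ab
      by auto
  qed
  have "AE x in M. real_cond_exp M F (\<lambda>x. Re (h x) * Re (f x) + - Im (h x) * Im (f x)) x
      = Re (h x) * real_cond_exp M F (\<lambda>x. Re (f x)) x + - Im (h x) * real_cond_exp M F (\<lambda>x. Im (f x)) x"
    "AE x in M. real_cond_exp M F (\<lambda>x. Re (h x) * Im (f x) + Im (h x) * Re (f x)) x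
      = Re (h x) * real_cond_exp M F (\<lambda>x. Im (f x)) x + Im (h x) * real_cond_exp M F (\<lambda>x. Re (f x)) x"
    using cond_exp_domain_Re_Im[OF f] by (intro lin; simp)+
  then show ?thesis
    unfolding complex_cond_exp_def by eventually_elim (simp add: complex_eq_iff)
qed

lemma complex_cond_exp_of_nonneg:
  fixes p :: "'a \<Rightarrow> real"
  assumes [measurable]: "p \<in> borel_measurable M" and "\<And>x. 0 \<le> p x"
  shows "AE x in M. CE (\<lambda>x. of_real (p x)) x = of_real (enn2real (NE p x))"
proof -
  have z: "AE x in M. NE (\<lambda>x. 0) x = 0"
    using nn_cond_exp_F_meas[of "\<lambda>_. 0"] by auto
  have *: "(\<lambda>x. ennreal (- p x)) = (\<lambda>x. 0)"
    using assms(2) by (auto simp: ennreal_neg)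
  from z show ?thesis
    unfolding complex_cond_exp_def real_cond_exp_def by eventually_elim (simp add: * complex_eq_iff)
qed

lemma complex_cond_exp_integral:
  assumes int: "integrable M f"
  shows "integrable M (CE f)" "(LINT x|M. CE f x) = (LINT x|M. f x)"
proof -
  have Re: "integrable M (\<lambda>x. Re (f x))" and Im: "integrable M (\<lambda>x. Im (f x))"
    using int by auto
  have eq: "CE f = (\<lambda>x. of_real (real_cond_exp M F (\<lambda>y. Re (f y)) x)
      + \<i> * of_real (real_cond_exp M F (\<lambda>y. Im (f y)) x))"
    by (simp add: complex_cond_exp_def Complex_eq fun_eq_iff)
  show i: "integrable M (CE f)"
    unfolding eq using real_cond_exp_int(1)[OF Re] real_cond_exp_int(1)[OF Im] by auto
  show "(LINT x|M. CE f x) = (LINT x|M. f x)"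
  proof (rule complex_eqI)
    show "Re (LINT x|M. CE f x) = Re (LINT x|M. f x)"
      using real_cond_exp_int(2)[OF Re] unfolding integral_Re[OF i, symmetric] integral_Re[OF int, symmetric]
      by (simp add: complex_cond_exp_def)
    show "Im (LINT x|M. CE f x) = Im (LINT x|M. f x)"
      using real_cond_exp_int(2)[OF Im] unfolding integral_Im[OF i, symmetric] integral_Im[OF int, symmetric]
      by (simp add: complex_cond_exp_def)
  qed
qed

end

section \<open>Square-integrable functions\<close>

lemma borel_measurable_cnj [measurable (raw)]:
  "f \<in> borel_measurable N \<Longrightarrow> (\<lambda>x. cnj (f x)) \<in> borel_measurable N"
  using borel_measurable_continuous_on[OF continuous_on_cnj[OF continuous_on_id], of f N] by simp

lemma L2_space_measurable [measurable_dest]: "f \<in> L2_space M \<Longrightarrow> f \<in> borel_measurable M"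
  by (simp add: L2_space_def)

lemma L2_space_iff:
  "f \<in> L2_space M \<longleftrightarrow> f \<in> borel_measurable M \<and> (\<integral>\<^sup>+x. ennreal ((cmod (f x))\<^sup>2) \<partial>M) < \<infinity>"
  by (auto simp: L2_space_def integrable_iff_bounded)

lemma L2_norm_sq:
  assumes "f \<in> L2_space M"
  shows "ennreal ((L2_norm M f)\<^sup>2) = (\<integral>\<^sup>+x. ennreal ((cmod (f x))\<^sup>2) \<partial>M)"
  using assms by (simp add: L2_norm_def L2_space_def nn_integral_eq_integral)

lemma L2_space_dominated:
  assumes [measurable]: "f \<in> borel_measurable M" and g: "g \<in> L2_space M"
    and le: "AE x in M. cmod (f x) \<le> cmod (g x)"
  shows "f \<in> L2_space M"
proof -
  have "(\<integral>\<^sup>+x. ennreal ((cmod (f x))\<^sup>2) \<partial>M) \<le> (\<integral>\<^sup>+x. ennreal ((cmod (g x))\<^sup>2) \<partial>M)"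
    using le by (intro nn_integral_mono_AE) (auto intro!: ennreal_leI power_mono)
  also have "\<dots> < \<infinity>" using g by (simp add: L2_space_iff)
  finally show ?thesis by (simp add: L2_space_iff)
qed

lemma L2_space_scale: "f \<in> L2_space M \<Longrightarrow> (\<lambda>x. c * f x) \<in> L2_space M"
  by (auto simp: L2_space_def norm_mult power_mult_distrib)

lemma norm_add_square_le: "(norm (a + b))\<^sup>2 \<le> 2 * ((norm a)\<^sup>2 + (norm b)\<^sup>2)"
proof -
  have "(norm (a + b))\<^sup>2 \<le> (norm a + norm b)\<^sup>2"
    by (intro power_mono norm_triangle_ineq) simp
  also have "\<dots> \<le> 2 * ((norm a)\<^sup>2 + (norm b)\<^sup>2)"
    using sum_squares_bound[of "norm a" "norm b"] by (simp add: power2_sum)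
  finally show ?thesis .
qed

lemma L2_space_add:
  assumes f: "f \<in> L2_space M" and g: "g \<in> L2_space M"
  shows "(\<lambda>x. f x + g x) \<in> L2_space M"
proof -
  note [measurable] = L2_space_measurable[OF f] L2_space_measurable[OF g]
  have int: "integrable M (\<lambda>x. 2 * ((cmod (f x))\<^sup>2 + (cmod (g x))\<^sup>2))"
    using f g by (simp add: L2_space_def)
  have "integrable M (\<lambda>x. (cmod (f x + g x))\<^sup>2)"
    by (rule Bochner_Integration.integrable_bound[OF int]) (use norm_add_square_le in auto)
  then show ?thesis
    by (simp add: L2_space_def)
qed

lemma L2_space_diff:
  assumes "f \<in> L2_space M" "g \<in> L2_space M"
  shows "(\<lambda>x. f x - g x) \<in> L2_space M"
  using L2_space_add[OF assms(1) L2_space_scale[OF assms(2), of "-1"]] by simp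

lemma L2_integrable_product:
  assumes f: "f \<in> L2_space M" and g: "g \<in> L2_space M"
  shows "integrable M (\<lambda>x. f x * cnj (g x))"
proof (rule Bochner_Integration.integrable_bound)
  note [measurable] = L2_space_measurable[OF f] L2_space_measurable[OF g]
  show "integrable M (\<lambda>x. (cmod (f x))\<^sup>2 + (cmod (g x))\<^sup>2)"
    using f g by (simp add: L2_space_def)
  show "(\<lambda>x. f x * cnj (g x)) \<in> borel_measurable M" by measurable
  have "cmod a * cmod b \<le> (cmod a)\<^sup>2 + (cmod b)\<^sup>2" for a b
    using sum_squares_bound[of "cmod a" "cmod b"] mult_nonneg_nonneg[OF norm_ge_zero[of a] norm_ge_zero[of b]]
    by linarith
  then show "AE x in M. norm (f x * cnj (g x)) \<le> norm ((cmod (f x))\<^sup>2 + (cmod (g x))\<^sup>2)"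
    by (simp add: norm_mult)
qed

lemma L2_inner_cong:
  assumes "ae_equal M f f'" "f \<in> borel_measurable M" "f' \<in> borel_measurable M"
    "g \<in> borel_measurable M"
  shows "L2_inner M f g = L2_inner M f' g"
  unfolding L2_inner_def
  using assms by (intro integral_cong_AE) (auto simp: ae_equal_def)

text \<open>
  Test with \<open>f = g - h\<close>.
\<close>

lemma L2_inner_eq_imp_ae_equal:
  assumes g: "g \<in> L2_space M" and h: "h \<in> L2_space M"
    and eq: "\<And>f. f \<in> L2_space M \<Longrightarrow> L2_inner M f g = L2_inner M f h"
  shows "ae_equal M g h"
proof -
  let ?d = "\<lambda>x. g x - h x"
  have d: "?d \<in> L2_space M" by (rule L2_space_diff[OF g h])
  have "complex_of_real (LINT x|M. (cmod (?d x))\<^sup>2) = (LINT x|M. complex_of_real ((cmod (?d x))\<^sup>2))"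
    by (rule integral_complex_of_real[symmetric])
  also have "\<dots> = (LINT x|M. ?d x * cnj (g x) - ?d x * cnj (h x))"
    by (simp only: complex_norm_square) (simp add: right_diff_distrib)
  also have "\<dots> = 0"
    using L2_integrable_product[OF d g] L2_integrable_product[OF d h] eq[OF d] by (simp add: L2_inner_def)
  finally have "(LINT x|M. (cmod (?d x))\<^sup>2) = 0" by simp
  moreover have "integrable M (\<lambda>x. (cmod (?d x))\<^sup>2)" using d by (simp add: L2_space_def)
  ultimately have "AE x in M. (cmod (?d x))\<^sup>2 = 0"
    by (simp add: integral_nonneg_eq_0_iff_AE)
  then show ?thesis unfolding ae_equal_def by eventually_elim simp
qed

text \<open>
  An adjoint found by any means is, up to null sets, the one selected in the definition.
\<close>

lemma L2_adjoint_unique: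
  assumes T': "L2_bounded_operator M T'"
    and adj: "\<And>f g. f \<in> L2_space M \<Longrightarrow> g \<in> L2_space M \<Longrightarrow> L2_inner M (T f) g = L2_inner M f (T' g)"
  shows "L2_bounded_operator M (L2_adjoint M T)"
    and "\<And>g. g \<in> L2_space M \<Longrightarrow> ae_equal M (L2_adjoint M T g) (T' g)"
proof -
  define P where "P = (\<lambda>T'. L2_bounded_operator M T' \<and>
        (\<forall>f\<in>L2_space M. \<forall>g\<in>L2_space M. L2_inner M (T f) g = L2_inner M f (T' g)))"
  have "P T'" using assms by (simp add: P_def)
  then have "P (L2_adjoint M T)"
    unfolding L2_adjoint_def P_def[symmetric] by (rule someI[of P])
  then show bdd: "L2_bounded_operator M (L2_adjoint M T)"
    and "\<And>g. g \<in> L2_space M \<Longrightarrow> ae_equal M (L2_adjoint M T g) (T' g)"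
  proof (auto simp: P_def)
    fix g assume *: "L2_bounded_operator M (L2_adjoint M T)"
      "\<forall>f\<in>L2_space M. \<forall>g\<in>L2_space M. L2_inner M (T f) g = L2_inner M f (L2_adjoint M T g)"
      and g: "g \<in> L2_space M"
    show "ae_equal M (L2_adjoint M T g) (T' g)"
      using * g T' adj by (intro L2_inner_eq_imp_ae_equal) (auto simp: L2_bounded_operator_def)
  qed
qed

section \<open>Functions with finite conditional second moment\<close>

context sigma_finite_subalgebra
begin

definition cond_L2 :: "('a \<Rightarrow> complex) set" where
  "cond_L2 = {f \<in> borel_measurable M. AE x in M. nn_cond_exp_sq M F f x < \<infinity>}"

text \<open>
  The value is zero where the conditional expectation is infinite; for members of \<open>cond_L2\<close> this
  happens on a null set only.
\<close>

definition second_moment :: "('a \<Rightarrow> complex) \<Rightarrow> 'a \<Rightarrow> real" where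
  "second_moment f x = enn2real (nn_cond_exp_sq M F f x)"

lemma nn_cond_exp_sq_measurable [measurable]:
  "nn_cond_exp_sq M F f \<in> borel_measurable F" "nn_cond_exp_sq M F f \<in> borel_measurable M"
  by (simp_all add: nn_cond_exp_sq_def)

lemma second_moment_measurable [measurable]:
  "second_moment f \<in> borel_measurable F" "second_moment f \<in> borel_measurable M"
  unfolding second_moment_def[abs_def] by measurable

lemma second_moment_nonneg [simp]: "0 \<le> second_moment f x"
  by (simp add: second_moment_def)

lemma cond_L2_measurable [measurable_dest]: "f \<in> cond_L2 \<Longrightarrow> f \<in> borel_measurable M"
  by (simp add: cond_L2_def)

lemma ennreal_second_moment:
  "f \<in> cond_L2 \<Longrightarrow> AE x in M. nn_cond_exp_sq M F f x = ennreal (second_moment f x)"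
  unfolding cond_L2_def second_moment_def by auto

lemma cnj_cond_L2: "f \<in> cond_L2 \<Longrightarrow> (\<lambda>x. cnj (f x)) \<in> cond_L2"
  by (auto simp: cond_L2_def nn_cond_exp_sq_def)

lemma second_moment_cnj: "second_moment (\<lambda>x. cnj (f x)) = second_moment f"
  by (simp add: second_moment_def[abs_def] nn_cond_exp_sq_def)

lemma L2_space_subset_cond_L2:
  assumes "f \<in> L2_space M"
  shows "f \<in> cond_L2"
proof -
  have [measurable]: "f \<in> borel_measurable M" using assms by (rule L2_space_measurable)
  have "(\<integral>\<^sup>+x. nn_cond_exp_sq M F f x \<partial>M) \<noteq> \<infinity>"
    using assms by (auto simp: nn_cond_exp_sq_def nn_integral_nn_cond_exp L2_space_iff)
  then have "AE x in M. nn_cond_exp_sq M F f x \<noteq> \<infinity>"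
    by (intro nn_integral_PInf_AE) auto
  then show ?thesis
    by (auto simp: cond_L2_def less_top)
qed

lemma cond_L2_product_in_domain:
  assumes f: "f \<in> cond_L2" and g: "g \<in> cond_L2"
  shows "(\<lambda>x. f x * g x) \<in> cond_exp_domain M F"
proof (rule cond_exp_domain_dominated)
  note [measurable] = cond_L2_measurable[OF f] cond_L2_measurable[OF g]
  let ?b = "\<lambda>x. ennreal ((cmod (f x))\<^sup>2) + ennreal ((cmod (g x))\<^sup>2)"
  show "(\<lambda>x. f x * g x) \<in> borel_measurable M" "?b \<in> borel_measurable M" by measurable
  have "cmod a * cmod b \<le> (cmod a)\<^sup>2 + (cmod b)\<^sup>2" for a b
    using sum_squares_bound[of "cmod a" "cmod b"] mult_nonneg_nonneg[OF norm_ge_zero[of a] norm_ge_zero[of b]]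
    by linarith
  then show "AE x in M. ennreal (cmod (f x * g x)) \<le> ?b x"
    by (auto simp: norm_mult ennreal_plus[symmetric] intro!: ennreal_leI simp del: ennreal_plus)
  have "AE x in M. nn_cond_exp_sq M F f x + nn_cond_exp_sq M F g x = NE ?b x"
    unfolding nn_cond_exp_sq_def by (intro nn_cond_exp_sum) auto
  moreover have "AE x in M. nn_cond_exp_sq M F f x < \<infinity>" "AE x in M. nn_cond_exp_sq M F g x < \<infinity>"
    using f g by (auto simp: cond_L2_def)
  ultimately show "AE x in M. NE ?b x < \<infinity>"
    by eventually_elim (metis ennreal_add_less_top infinity_ennreal_def)
qed

lemma cond_L2_add:
  assumes f: "f \<in> cond_L2" and g: "g \<in> cond_L2"
  shows "(\<lambda>x. f x + g x) \<in> cond_L2"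
proof -
  note [measurable] = cond_L2_measurable[OF f] cond_L2_measurable[OF g]
  let ?f = "\<lambda>x. ennreal ((cmod (f x))\<^sup>2)" and ?g = "\<lambda>x. ennreal ((cmod (g x))\<^sup>2)"
  have "ennreal ((cmod (f x + g x))\<^sup>2) \<le> 2 * (?f x + ?g x)" for x
  proof -
    have "ennreal ((cmod (f x + g x))\<^sup>2) \<le> ennreal (2 * ((cmod (f x))\<^sup>2 + (cmod (g x))\<^sup>2))"
      by (intro ennreal_leI norm_add_square_le)
    also have "\<dots> = 2 * (?f x + ?g x)"
      by (simp add: ennreal_mult)
    finally show ?thesis .
  qed
  then have "AE x in M. nn_cond_exp_sq M F (\<lambda>x. f x + g x) x \<le> NE (\<lambda>x. 2 * (?f x + ?g x)) x"
    unfolding nn_cond_exp_sq_def by (intro nn_cond_exp_mono) auto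
  moreover have "AE x in M. 2 * NE (\<lambda>x. ?f x + ?g x) x = NE (\<lambda>x. 2 * (?f x + ?g x)) x"
    by (intro nn_cond_exp_prod) auto
  moreover have "AE x in M. NE ?f x + NE ?g x = NE (\<lambda>x. ?f x + ?g x) x"
    by (intro nn_cond_exp_sum) auto
  moreover have "AE x in M. NE ?f x < \<infinity>" "AE x in M. NE ?g x < \<infinity>"
    using f g by (auto simp: cond_L2_def nn_cond_exp_sq_def)
  ultimately have "AE x in M. nn_cond_exp_sq M F (\<lambda>x. f x + g x) x < \<infinity>"
  proof eventually_elim
    case (elim x)
    have "NE ?f x + NE ?g x < \<infinity>"
      using elim(4,5) by simp
    then have "2 * (NE ?f x + NE ?g x) < \<infinity>"
      unfolding ennreal_mult_less_top infinity_ennreal_def by (intro disjI2 conjI) auto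
    with elim(1) show ?case
      unfolding elim(3) elim(2) by (rule order.strict_trans1)
  qed
  then show ?thesis by (simp add: cond_L2_def)
qed

lemma nn_cond_exp_sq_mult:
  assumes h: "h \<in> borel_measurable F" and [measurable]: "f \<in> borel_measurable M"
  shows "AE x in M. nn_cond_exp_sq M F (\<lambda>x. h x * f x) x = ennreal ((cmod (h x))\<^sup>2) * nn_cond_exp_sq M F f x"
proof -
  note [measurable] = h
  have "AE x in M. ennreal ((cmod (h x))\<^sup>2) * NE (\<lambda>x. ennreal ((cmod (f x))\<^sup>2)) x
      = NE (\<lambda>x. ennreal ((cmod (h x))\<^sup>2) * ennreal ((cmod (f x))\<^sup>2)) x"
    by (intro nn_cond_exp_prod) auto
  then show ?thesis
    unfolding nn_cond_exp_sq_def norm_mult power_mult_distrib by eventually_elim (simp add: ennreal_mult)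
qed

lemma cond_L2_mult:
  assumes h: "h \<in> borel_measurable F" and f: "f \<in> cond_L2"
  shows "(\<lambda>x. h x * f x) \<in> cond_L2"
proof -
  note [measurable] = cond_L2_measurable[OF f] measurable_lift[OF h]
  have "AE x in M. nn_cond_exp_sq M F f x < \<infinity>"
    using f by (simp add: cond_L2_def)
  with nn_cond_exp_sq_mult[OF h cond_L2_measurable[OF f]]
  have "AE x in M. nn_cond_exp_sq M F (\<lambda>x. h x * f x) x < \<infinity>"
    by eventually_elim (metis ennreal_less_top ennreal_mult_less_top infinity_ennreal_def)
  then show ?thesis by (simp add: cond_L2_def)
qed

lemma complex_cond_exp_norm_square:
  assumes [measurable]: "f \<in> borel_measurable M"
  shows "AE x in M. CE (\<lambda>x. f x * cnj (f x)) x = of_real (second_moment f x)"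
  using complex_cond_exp_of_nonneg[of "\<lambda>x. (cmod (f x))\<^sup>2"]
  by (simp add: complex_norm_square second_moment_def nn_cond_exp_sq_def del: of_real_power)

text \<open>
  A function that is measurable for the subalgebra acts as a scalar, so the second moment expands
  like a squared norm, with \<open>E(f g)\<close> as the inner product of \<open>f\<close> and the conjugate of \<open>g\<close>.  The
  choice \<open>c = E(f g) / E|g|\<^sup>2\<close> yields the Cauchy-Schwarz inequality and its case of equality.
\<close>

lemma second_moment_diff:
  assumes f: "f \<in> cond_L2" and g: "g \<in> cond_L2" and c: "c \<in> borel_measurable F"
  shows "AE x in M. second_moment (\<lambda>x. f x - c x * cnj (g x)) x
    = second_moment f x - 2 * Re (cnj (c x) * CE (\<lambda>x. f x * g x) x) + (cmod (c x))\<^sup>2 * second_moment g x"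
proof -
  note [measurable] = cond_L2_measurable[OF f] cond_L2_measurable[OF g] c measurable_lift[OF c]
  let ?fg = "\<lambda>x. f x * g x"
  let ?d = "\<lambda>x. f x - c x * cnj (g x)"
  let ?p = "\<lambda>x. f x * cnj (f x)" and ?q = "\<lambda>x. - cnj (c x) * ?fg x"
    and ?r = "\<lambda>x. - c x * cnj (?fg x)" and ?s = "\<lambda>x. (c x * cnj (c x)) * (g x * cnj (g x))"
  have exp: "(\<lambda>x. ?d x * cnj (?d x)) = (\<lambda>x. ?p x + (?q x + (?r x + ?s x)))"
    by (simp add: fun_eq_iff algebra_simps)
  have fg: "?fg \<in> cond_exp_domain M F" and fg': "(\<lambda>x. cnj (?fg x)) \<in> cond_exp_domain M F"
    and ff: "?p \<in> cond_exp_domain M F" and gg: "(\<lambda>x. g x * cnj (g x)) \<in> cond_exp_domain M F"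
    using cond_L2_product_in_domain f g cnj_cond_L2 by auto
  have q: "?q \<in> cond_exp_domain M F" and r: "?r \<in> cond_exp_domain M F" and s: "?s \<in> cond_exp_domain M F"
    using cond_exp_domain_mult[OF _ fg, of "\<lambda>x. - cnj (c x)"]
      cond_exp_domain_mult[OF _ fg', of "\<lambda>x. - c x"]
      cond_exp_domain_mult[OF _ gg, of "\<lambda>x. c x * cnj (c x)"] by auto
  have "AE x in M. CE (\<lambda>x. ?d x * cnj (?d x)) x = CE ?p x + (CE ?q x + (CE ?r x + CE ?s x))"
    unfolding exp
    using complex_cond_exp_add[OF ff cond_exp_domain_add[OF q cond_exp_domain_add[OF r s]]]
      complex_cond_exp_add[OF q cond_exp_domain_add[OF r s]] complex_cond_exp_add[OF r s]
    by eventually_elim simp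
  moreover have "AE x in M. CE ?q x = - cnj (c x) * CE ?fg x"
    by (intro complex_cond_exp_mult fg) measurable
  moreover have "AE x in M. CE ?r x = - c x * CE (\<lambda>x. cnj (?fg x)) x"
    by (intro complex_cond_exp_mult fg') measurable
  moreover have "AE x in M. CE ?s x = (c x * cnj (c x)) * CE (\<lambda>x. g x * cnj (g x)) x"
    by (intro complex_cond_exp_mult gg) measurable
  moreover have "AE x in M. CE (\<lambda>x. ?d x * cnj (?d x)) x = of_real (second_moment ?d x)"
    by (intro complex_cond_exp_norm_square) measurable
  moreover note complex_cond_exp_norm_square[OF cond_L2_measurable[OF f]]
    complex_cond_exp_norm_square[OF cond_L2_measurable[OF g]]
  ultimately show ?thesis
  proof eventually_elim
    case (elim x)
    have "complex_of_real (second_moment ?d x) = CE ?p x + (CE ?q x + (CE ?r x + CE ?s x))"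
      using elim(1) unfolding elim(5) .
    also have "\<dots> = of_real (second_moment f x) - cnj (c x) * CE ?fg x
        - cnj (cnj (c x) * CE ?fg x) + of_real ((cmod (c x))\<^sup>2) * of_real (second_moment g x)"
      unfolding elim(2-4) elim(6,7) complex_cond_exp_cnj complex_norm_square by simp
    finally show ?case
      unfolding of_real_mult[symmetric] by (auto dest: arg_cong[of _ _ Re])
  qed
qed

lemma cond_Cauchy_Schwarz:
  assumes f: "f \<in> cond_L2" and g: "g \<in> cond_L2"
  shows "AE x in M. (cmod (CE (\<lambda>x. f x * g x) x))\<^sup>2 \<le> second_moment f x * second_moment g x"
proof -
  let ?q = "CE (\<lambda>x. f x * g x)" and ?a = "second_moment f" and ?b = "second_moment g"
  \<comment> \<open>Where the second moment of \<open>g\<close> vanishes, \<open>c\<close> is so large that \<open>CE (f g) \<noteq> 0\<close> would make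
    the second moment of the difference negative.\<close>
  define c where "c x = (if ?b x = 0 then of_real ((?a x + 1) / (cmod (?q x))\<^sup>2) * ?q x else ?q x / of_real (?b x))" for x
  have c: "c \<in> borel_measurable F"
    unfolding c_def[abs_def] by measurable
  from second_moment_diff[OF f g c] show ?thesis
  proof eventually_elim
    case (elim x)
    have nonneg: "0 \<le> ?a x - 2 * Re (cnj (c x) * ?q x) + (cmod (c x))\<^sup>2 * ?b x"
      unfolding elim[symmetric] by simp
    have re: "Re (of_real t * z) = t * Re z" for t z
      by simp
    have qq: "Re (cnj (?q x) * ?q x) = (cmod (?q x))\<^sup>2"
      by (simp only: cmod_power2) (simp add: power2_eq_square)
    show ?case
    proof (cases "?q x = 0 \<or> ?b x = 0")
      case True
      have "?q x = 0"
      proof (rule ccontr)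
        assume q: "?q x \<noteq> 0"
        with True have b: "?b x = 0" by simp
        have "cnj (c x) * ?q x = of_real ((?a x + 1) / (cmod (?q x))\<^sup>2) * (cnj (?q x) * ?q x)"
          by (simp add: c_def b)
        then have "Re (cnj (c x) * ?q x) = ((?a x + 1) / (cmod (?q x))\<^sup>2) * (cmod (?q x))\<^sup>2"
          by (simp only: re qq)
        then have "Re (cnj (c x) * ?q x) = ?a x + 1" using q by simp
        from nonneg[unfolded this b] have "0 \<le> ?a x - 2 * (?a x + 1)" by simp
        moreover have False if "0 \<le> t" "0 \<le> t - 2 * (t + 1)" for t :: real
          using that by (simp add: algebra_simps)
        ultimately show False using second_moment_nonneg by blast
      qed
      then show ?thesis by simp
    next
      case False
      then have b: "?b x > 0" using second_moment_nonneg[of g x] by linarith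
      have "cnj (c x) * ?q x = of_real (1 / ?b x) * (cnj (?q x) * ?q x)"
        using b by (simp add: c_def)
      then have "Re (cnj (c x) * ?q x) = (1 / ?b x) * (cmod (?q x))\<^sup>2"
        by (simp only: re qq)
      moreover have "(cmod (c x))\<^sup>2 * ?b x = (cmod (?q x))\<^sup>2 / ?b x"
        using b by (simp add: c_def norm_divide power_divide power2_eq_square)
      ultimately have "0 \<le> ?a x - 2 * (1 / ?b x * (cmod (?q x))\<^sup>2) + (cmod (?q x))\<^sup>2 / ?b x"
        using nonneg by simp
      then show ?thesis
        using b by (simp add: field_simps)
    qed
  qed
qed

lemma second_moment_eq_0_imp_zero:
  assumes f: "f \<in> cond_L2"
  shows "AE x in M. second_moment f x = 0 \<longrightarrow> f x = 0"
proof -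
  note [measurable] = cond_L2_measurable[OF f]
  have "AE x in M. nn_cond_exp_sq M F f x = 0 \<longrightarrow> ennreal ((cmod (f x))\<^sup>2) = 0"
    unfolding nn_cond_exp_sq_def by (intro nn_cond_exp_eq_0_imp_zero) measurable
  with ennreal_second_moment[OF f] show ?thesis
    by eventually_elim (auto simp: second_moment_def)
qed

text \<open>
  By \<open>\<sigma>\<close>-finiteness of the subalgebra there is a strictly positive integrable \<open>h\<close> that is
  measurable for it, and the weight \<open>sqrt (h / (1 + E|f|\<^sup>2))\<close> works.  Such a weight cancels from
  identities between conditional expectations, so these may be tested on functions with finite
  conditional second moment as if they were square-integrable.
\<close>

lemma ex_positive_weight_L2:
  assumes f: "f \<in> cond_L2"
  obtains \<psi> :: "'a \<Rightarrow> real" where "\<psi> \<in> borel_measurable F" "AE x in M. 0 < \<psi> x"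
    "(\<lambda>x. of_real (\<psi> x) * f x) \<in> L2_space M"
proof -
  note [measurable] = cond_L2_measurable[OF f]
  interpret R: sigma_finite_measure "restr_to_subalg M F" by (rule sigma_fin_subalg)
  obtain h where h: "h \<in> borel_measurable (restr_to_subalg M F)"
    "(\<integral>\<^sup>+x. h x \<partial>restr_to_subalg M F) \<noteq> \<infinity>" "\<And>x. x \<in> space M \<Longrightarrow> 0 < h x \<and> h x < \<infinity>"
    using R.Ex_finite_integrable_function by (auto simp: space_restr_to_subalg)
  have hF[measurable]: "h \<in> borel_measurable F"
    by (rule measurable_in_subalg'[OF subalg h(1)])
  have [measurable]: "h \<in> borel_measurable M" by (rule measurable_lift[OF hF])
  have h_int: "(\<integral>\<^sup>+x. h x \<partial>M) < \<infinity>"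
    using h(2) nn_integral_subalgebra2[OF subalg hF] by (simp add: less_top)
  define \<psi> where "\<psi> x = sqrt (enn2real (h x) / (1 + second_moment f x))" for x
  have \<psi>F[measurable]: "\<psi> \<in> borel_measurable F"
    unfolding \<psi>_def[abs_def] by measurable
  have [measurable]: "\<psi> \<in> borel_measurable M" by (rule measurable_lift[OF \<psi>F])
  have pos: "0 < \<psi> x" if "x \<in> space M" for x
    using h(3)[OF that] by (auto simp: \<psi>_def enn2real_positive_iff add_pos_nonneg intro!: divide_pos_pos)
  have "(\<integral>\<^sup>+x. ennreal ((cmod (of_real (\<psi> x) * f x))\<^sup>2) \<partial>M)
      = (\<integral>\<^sup>+x. ennreal ((\<psi> x)\<^sup>2) * ennreal ((cmod (f x))\<^sup>2) \<partial>M)"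
    by (simp add: norm_mult power_mult_distrib ennreal_mult)
  also have "\<dots> = (\<integral>\<^sup>+x. ennreal ((\<psi> x)\<^sup>2) * nn_cond_exp_sq M F f x \<partial>M)"
    unfolding nn_cond_exp_sq_def by (intro nn_cond_exp_intg[symmetric]) auto
  also have "\<dots> \<le> (\<integral>\<^sup>+x. h x \<partial>M)"
  proof (rule nn_integral_mono_AE)
    show "AE x in M. ennreal ((\<psi> x)\<^sup>2) * nn_cond_exp_sq M F f x \<le> h x"
      using ennreal_second_moment[OF f] AE_space
    proof eventually_elim
      case (elim x)
      have "(\<psi> x)\<^sup>2 = enn2real (h x) / (1 + second_moment f x)"
        by (simp add: \<psi>_def add_nonneg_nonneg)
      then have "(\<psi> x)\<^sup>2 * second_moment f x \<le> enn2real (h x)"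
        by (simp add: field_simps add_pos_nonneg)
      then have "ennreal ((\<psi> x)\<^sup>2 * second_moment f x) \<le> h x"
        using h(3)[OF elim(2)] by (metis ennreal_enn2real ennreal_leI infinity_ennreal_def)
      with elim(1) show ?case by (simp add: ennreal_mult)
    qed
  qed
  also note h_int
  finally have "(\<lambda>x. of_real (\<psi> x) * f x) \<in> L2_space M"
    by (simp add: L2_space_iff)
  with \<psi>F show thesis
    using pos
    by (intro that[of \<psi>]) (auto intro: AE_I2)
qed

end

section \<open>Weighted conditional operators and their compositions\<close>

context sigma_finite_subalgebra
begin

text \<open>
  The factor \<open>\<phi>\<close>, which is to be measurable for the subalgebra, could be absorbed into \<open>p\<close>.  It is
  kept apart so that all compositions of an operator and its adjoint have \<open>p\<close> and \<open>r\<close> among the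
  original weights and their conjugates, and differ in \<open>\<phi>\<close> only.
\<close>

definition scaled_cond_op ::
  "('a \<Rightarrow> complex) \<Rightarrow> ('a \<Rightarrow> complex) \<Rightarrow> ('a \<Rightarrow> complex) \<Rightarrow> ('a \<Rightarrow> complex) \<Rightarrow> 'a \<Rightarrow> complex" where
  "scaled_cond_op \<phi> p r f = (\<lambda>x. \<phi> x * weighted_cond_op M F p r f x)"

lemma weighted_cond_op_measurable [measurable]:
  "p \<in> borel_measurable M \<Longrightarrow> weighted_cond_op M F p r f \<in> borel_measurable M"
  unfolding weighted_cond_op_def by (intro borel_measurable_times complex_cond_exp_measurable)

lemma weighted_cond_op_cong:
  assumes "ae_equal M f g" "f \<in> borel_measurable M" "g \<in> borel_measurable M" "r \<in> borel_measurable M"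
  shows "ae_equal M (weighted_cond_op M F p r f) (weighted_cond_op M F p r g)"
proof -
  have "AE x in M. CE (\<lambda>y. r y * f y) x = CE (\<lambda>y. r y * g y) x"
    using assms by (intro complex_cond_exp_cong) (auto simp: ae_equal_def)
  then show ?thesis
    unfolding ae_equal_def weighted_cond_op_def by eventually_elim simp
qed

text \<open>
  The outer expectation is applied to \<open>\<phi>' E(r' f)\<close> times \<open>r p'\<close>, and the first of these is
  measurable for the subalgebra.
\<close>

lemma scaled_cond_op_comp:
  assumes "r \<in> cond_L2" "p' \<in> cond_L2" "\<phi>' \<in> borel_measurable F"
  shows "ae_equal M (scaled_cond_op \<phi> p r (scaled_cond_op \<phi>' p' r' f))
    (scaled_cond_op (\<lambda>x. \<phi> x * \<phi>' x * CE (\<lambda>y. r y * p' y) x) p r' f)"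
proof -
  have "AE x in M. CE (\<lambda>y. (\<phi>' y * CE (\<lambda>z. r' z * f z) y) * (r y * p' y)) x
      = (\<phi>' x * CE (\<lambda>z. r' z * f z) x) * CE (\<lambda>y. r y * p' y) x"
    using assms
    by (intro complex_cond_exp_mult cond_L2_product_in_domain borel_measurable_times complex_cond_exp_measurable_F)
  then show ?thesis
    unfolding ae_equal_def scaled_cond_op_def weighted_cond_op_def
    by eventually_elim (simp add: mult_ac)
qed

text \<open>
  Operators are compared on square-integrable functions only, and up to null sets: nothing more is
  known of the adjoint, which is a chosen representative.
\<close>

definition represented_by ::
  "(('a \<Rightarrow> complex) \<Rightarrow> 'a \<Rightarrow> complex) \<Rightarrow> ('a \<Rightarrow> complex) \<Rightarrow> ('a \<Rightarrow> complex) \<Rightarrow> ('a \<Rightarrow> complex) \<Rightarrow> bool" where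
  "represented_by X \<phi> p r \<longleftrightarrow> \<phi> \<in> borel_measurable F \<and> p \<in> cond_L2 \<and> r \<in> cond_L2 \<and>
     (\<forall>f\<in>L2_space M. X f \<in> L2_space M \<and> ae_equal M (X f) (scaled_cond_op \<phi> p r f))"

lemma represented_by_comp:
  assumes X: "represented_by X \<phi> p r" and Y: "represented_by Y \<phi>' p' r'"
  shows "represented_by (X \<circ> Y) (\<lambda>x. \<phi> x * \<phi>' x * CE (\<lambda>y. r y * p' y) x) p r'"
  unfolding represented_by_def
proof (intro conjI ballI)
  have F[measurable]: "\<phi> \<in> borel_measurable F" "\<phi>' \<in> borel_measurable F"
    using X Y by (auto simp: represented_by_def)
  have [measurable]: "\<phi>' \<in> borel_measurable M" by (rule measurable_lift[OF F(2)])
  show "(\<lambda>x. \<phi> x * \<phi>' x * CE (\<lambda>y. r y * p' y) x) \<in> borel_measurable F" by measurable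
  have L: "p \<in> cond_L2" "r \<in> cond_L2" "p' \<in> cond_L2" "r' \<in> cond_L2"
    using X Y by (auto simp: represented_by_def)
  then show "p \<in> cond_L2" "r' \<in> cond_L2" by auto
  note [measurable] = L[THEN cond_L2_measurable]
  fix f assume f: "f \<in> L2_space M"
  have Yf: "Y f \<in> L2_space M" "ae_equal M (Y f) (scaled_cond_op \<phi>' p' r' f)"
    using Y f by (auto simp: represented_by_def)
  have XYf: "X (Y f) \<in> L2_space M" "ae_equal M (X (Y f)) (scaled_cond_op \<phi> p r (Y f))"
    using X Yf(1) by (auto simp: represented_by_def)
  then show "(X \<circ> Y) f \<in> L2_space M" by simp
  have m: "scaled_cond_op \<phi>' p' r' f \<in> borel_measurable M"
    unfolding scaled_cond_op_def by measurable
  have "ae_equal M (weighted_cond_op M F p r (Y f)) (weighted_cond_op M F p r (scaled_cond_op \<phi>' p' r' f))"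
    using Yf m L by (intro weighted_cond_op_cong) (auto intro: L2_space_measurable cond_L2_measurable)
  with XYf(2) scaled_cond_op_comp[OF L(2,3) F(2), of \<phi> p r' f]
  show "ae_equal M ((X \<circ> Y) f) (scaled_cond_op (\<lambda>x. \<phi> x * \<phi>' x * CE (\<lambda>y. r y * p' y) x) p r' f)"
    unfolding ae_equal_def scaled_cond_op_def[of \<phi> p r] by (auto elim!: AE_mp)
qed

lemma represented_by_funpow:
  assumes R: "represented_by R (\<lambda>_. 1) p r"
  shows "represented_by (R ^^ Suc n) (\<lambda>x. CE (\<lambda>y. r y * p y) x ^ n) p r"
proof (induction n)
  case 0
  then show ?case using R by (simp add: comp_def)
next
  case (Suc n)
  have "R ^^ Suc (Suc n) = R \<circ> R ^^ Suc n"
    by (simp only: funpow.simps)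
  with represented_by_comp[OF R Suc.IH] show ?case
    by (simp only: mult_1_left power_Suc2)
qed

text \<open>
  If \<open>p = p'\<close> and \<open>r = r'\<close>, the two sides coincide, so operators that differ in their scalar factor
  only always commute.
\<close>

lemma represented_by_commute_iff:
  assumes X: "represented_by X \<phi> p r" and Y: "represented_by Y \<phi>' p' r'" and f: "f \<in> L2_space M"
  shows "ae_equal M (X (Y f)) (Y (X f)) \<longleftrightarrow>
    (AE x in M. \<phi> x * \<phi>' x * (CE (\<lambda>y. r y * p' y) x * weighted_cond_op M F p r' f x)
      = \<phi> x * \<phi>' x * (CE (\<lambda>y. r' y * p y) x * weighted_cond_op M F p' r f x))"
proof -
  have "AE x in M. X (Y f) x = \<phi> x * \<phi>' x * (CE (\<lambda>y. r y * p' y) x * weighted_cond_op M F p r' f x)"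
    "AE x in M. Y (X f) x = \<phi> x * \<phi>' x * (CE (\<lambda>y. r' y * p y) x * weighted_cond_op M F p' r f x)"
    using represented_by_comp[OF X Y] represented_by_comp[OF Y X] f
    by (auto simp: represented_by_def ae_equal_def scaled_cond_op_def mult_ac)
  then show ?thesis
    unfolding ae_equal_def by (intro iffI; elim AE_mp; auto elim!: AE_mp)
qed

section \<open>Boundedness and adjoints\<close>

text \<open>
  By the conditional Cauchy-Schwarz inequality, \<open>E|p|\<^sup>2 |E(r f)|\<^sup>2 \<le> E|p|\<^sup>2 E|r|\<^sup>2 E|f|\<^sup>2\<close>.
\<close>

lemma nn_integral_weighted_cond_op_le:
  assumes p: "p \<in> cond_L2" and r: "r \<in> cond_L2" and f: "f \<in> L2_space M"
    and K: "AE x in M. second_moment p x * second_moment r x \<le> K"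
  shows "(\<integral>\<^sup>+x. ennreal ((cmod (weighted_cond_op M F p r f x))\<^sup>2) \<partial>M)
    \<le> ennreal K * (\<integral>\<^sup>+x. ennreal ((cmod (f x))\<^sup>2) \<partial>M)"
proof -
  note [measurable] = L2_space_measurable[OF f] cond_L2_measurable[OF p] cond_L2_measurable[OF r]
  have f': "f \<in> cond_L2" by (rule L2_space_subset_cond_L2[OF f])
  let ?e = "CE (\<lambda>y. r y * f y)"
  have "(\<integral>\<^sup>+x. ennreal ((cmod (weighted_cond_op M F p r f x))\<^sup>2) \<partial>M)
      = (\<integral>\<^sup>+x. ennreal ((cmod (?e x))\<^sup>2) * ennreal ((cmod (p x))\<^sup>2) \<partial>M)"
    by (simp add: weighted_cond_op_def norm_mult power_mult_distrib ennreal_mult mult.commute)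
  also have "\<dots> = (\<integral>\<^sup>+x. ennreal ((cmod (?e x))\<^sup>2) * nn_cond_exp_sq M F p x \<partial>M)"
    unfolding nn_cond_exp_sq_def by (intro nn_cond_exp_intg[symmetric]) auto
  also have "\<dots> \<le> (\<integral>\<^sup>+x. ennreal K * nn_cond_exp_sq M F f x \<partial>M)"
  proof (rule nn_integral_mono_AE)
    show "AE x in M. ennreal ((cmod (?e x))\<^sup>2) * nn_cond_exp_sq M F p x \<le> ennreal K * nn_cond_exp_sq M F f x"
      using K cond_Cauchy_Schwarz[OF r f'] ennreal_second_moment[OF p] ennreal_second_moment[OF f']
    proof eventually_elim
      case (elim x)
      have "(cmod (?e x))\<^sup>2 * second_moment p x \<le> (second_moment r x * second_moment f x) * second_moment p x"
        by (intro mult_right_mono elim(2)) simp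
      also have "\<dots> = (second_moment p x * second_moment r x) * second_moment f x"
        by (simp add: mult_ac)
      also have "\<dots> \<le> K * second_moment f x"
        by (intro mult_right_mono elim(1)) simp
      finally have "ennreal ((cmod (?e x))\<^sup>2 * second_moment p x) \<le> ennreal (K * second_moment f x)"
        by (rule ennreal_leI)
      then show ?case
        unfolding elim(3,4) by (simp add: ennreal_mult'')
    qed
  qed
  also have "\<dots> = ennreal K * (\<integral>\<^sup>+x. ennreal ((cmod (f x))\<^sup>2) \<partial>M)"
    by (simp add: nn_integral_cmult nn_cond_exp_sq_def nn_integral_nn_cond_exp)
  finally show ?thesis .
qed

lemma weighted_cond_op_bounded:
  assumes p: "p \<in> cond_L2" and r: "r \<in> cond_L2"
    and K: "AE x in M. second_moment p x * second_moment r x \<le> K"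
  shows "L2_bounded_operator M (weighted_cond_op M F p r)"
  unfolding L2_bounded_operator_def
proof (intro conjI ballI impI allI)
  note [measurable] = cond_L2_measurable[OF p] cond_L2_measurable[OF r]
  let ?W = "weighted_cond_op M F p r"
  show maps: "?W f \<in> L2_space M" if f: "f \<in> L2_space M" for f
  proof -
    have "ennreal K * (\<integral>\<^sup>+x. ennreal ((cmod (f x))\<^sup>2) \<partial>M) < \<infinity>"
      using f by (simp add: L2_space_iff ennreal_mult_less_top)
    with nn_integral_weighted_cond_op_le[OF p r f K] show ?thesis
      by (auto simp: L2_space_iff intro: order.strict_trans1)
  qed
  show "ae_equal M (?W f) (?W g)" if "f \<in> L2_space M" "g \<in> L2_space M" "ae_equal M f g" for f g
    using that by (intro weighted_cond_op_cong) (auto intro: L2_space_measurable)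
  show "ae_equal M (?W (\<lambda>x. a * f x + b * g x)) (\<lambda>x. a * ?W f x + b * ?W g x)"
    if f: "f \<in> L2_space M" and g: "g \<in> L2_space M" for f g a b
  proof -
    have rf: "(\<lambda>y. r y * f y) \<in> cond_exp_domain M F" and rg: "(\<lambda>y. r y * g y) \<in> cond_exp_domain M F"
      using r f g by (auto intro: cond_L2_product_in_domain L2_space_subset_cond_L2)
    have ca: "(\<lambda>y. a * (r y * f y)) \<in> cond_exp_domain M F" and cb: "(\<lambda>y. b * (r y * g y)) \<in> cond_exp_domain M F"
      using cond_exp_domain_mult[OF _ rf, of "\<lambda>_. a"] cond_exp_domain_mult[OF _ rg, of "\<lambda>_. b"] by auto
    have eq: "(\<lambda>y. r y * (a * f y + b * g y)) = (\<lambda>y. a * (r y * f y) + b * (r y * g y))"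
      by (simp add: fun_eq_iff algebra_simps)
    have "AE x in M. CE (\<lambda>y. a * (r y * f y)) x = a * CE (\<lambda>y. r y * f y) x"
      "AE x in M. CE (\<lambda>y. b * (r y * g y)) x = b * CE (\<lambda>y. r y * g y) x"
      using complex_cond_exp_mult[OF _ rf, of "\<lambda>_. a"] complex_cond_exp_mult[OF _ rg, of "\<lambda>_. b"] by auto
    with complex_cond_exp_add[OF ca cb] show ?thesis
      unfolding ae_equal_def weighted_cond_op_def eq by eventually_elim (simp add: algebra_simps)
  qed
  show "\<exists>C. \<forall>f\<in>L2_space M. L2_norm M (?W f) \<le> C * L2_norm M f"
  proof (intro exI[of _ "sqrt \<bar>K\<bar>"] ballI)
    fix f assume f: "f \<in> L2_space M"
    have "ennreal ((L2_norm M (?W f))\<^sup>2) \<le> ennreal K * ennreal ((L2_norm M f)\<^sup>2)"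
      using nn_integral_weighted_cond_op_le[OF p r f K] by (simp add: L2_norm_sq f maps)
    also have "\<dots> \<le> ennreal \<bar>K\<bar> * ennreal ((L2_norm M f)\<^sup>2)"
      by (intro mult_right_mono ennreal_leI) auto
    also have "\<dots> = ennreal ((sqrt \<bar>K\<bar> * L2_norm M f)\<^sup>2)"
      by (simp add: ennreal_mult power_mult_distrib)
    finally have "(L2_norm M (?W f))\<^sup>2 \<le> (sqrt \<bar>K\<bar> * L2_norm M f)\<^sup>2"
      by simp
    then show "L2_norm M (?W f) \<le> sqrt \<bar>K\<bar> * L2_norm M f"
      by (rule power2_le_imp_le) (simp add: L2_norm_def)
  qed
qed

lemma complex_cond_exp_integral_mult:
  assumes h: "h \<in> borel_measurable F" and k: "k \<in> cond_exp_domain M F"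
    and int: "integrable M (\<lambda>x. h x * k x)"
  shows "(LINT x|M. h x * k x) = (LINT x|M. h x * CE k x)"
proof -
  note [measurable] = h measurable_lift[OF h]
  have "(LINT x|M. h x * k x) = (LINT x|M. CE (\<lambda>x. h x * k x) x)"
    by (rule complex_cond_exp_integral(2)[OF int, symmetric])
  also have "\<dots> = (LINT x|M. h x * CE k x)"
    by (intro integral_cong_AE complex_cond_exp_mult h k) measurable
  finally show ?thesis .
qed

text \<open>
  Both sides equal the integral of \<open>E(r f) E(p cnj g)\<close>.
\<close>

lemma weighted_cond_op_adjoint:
  assumes p: "p \<in> cond_L2" and r: "r \<in> cond_L2" and f: "f \<in> L2_space M" and g: "g \<in> L2_space M"
    and K: "AE x in M. second_moment p x * second_moment r x \<le> K"
  shows "L2_inner M (weighted_cond_op M F p r f) g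
    = L2_inner M f (weighted_cond_op M F (\<lambda>x. cnj (r x)) (\<lambda>x. cnj (p x)) g)"
proof -
  let ?e = "CE (\<lambda>y. r y * f y)" and ?d = "CE (\<lambda>y. p y * cnj (g y))"
  let ?W = "weighted_cond_op M F p r" and ?V = "weighted_cond_op M F (\<lambda>x. cnj (r x)) (\<lambda>x. cnj (p x))"
  have K': "AE x in M. second_moment (\<lambda>x. cnj (r x)) x * second_moment (\<lambda>x. cnj (p x)) x \<le> K"
    using K by (simp add: second_moment_cnj mult.commute)
  have W: "?W f \<in> L2_space M" and V: "?V g \<in> L2_space M"
    using weighted_cond_op_bounded[OF p r K] weighted_cond_op_bounded[OF cnj_cond_L2[OF r] cnj_cond_L2[OF p] K'] f g
    by (auto simp: L2_bounded_operator_def)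
  have rf: "(\<lambda>y. r y * f y) \<in> cond_exp_domain M F"
    by (intro cond_L2_product_in_domain r L2_space_subset_cond_L2 f)
  have pg: "(\<lambda>y. p y * cnj (g y)) \<in> cond_exp_domain M F"
    by (intro cond_L2_product_in_domain p cnj_cond_L2 L2_space_subset_cond_L2 g)
  have dV: "cnj (?V g x) = ?d x * r x" for x
    using fun_cong[OF complex_cond_exp_cnj[of "\<lambda>y. p y * cnj (g y)"], of x]
    by (simp add: weighted_cond_op_def mult.commute)
  have "L2_inner M (?W f) g = (LINT x|M. ?e x * (p x * cnj (g x)))"
    by (simp add: L2_inner_def weighted_cond_op_def mult_ac)
  also have "\<dots> = (LINT x|M. ?e x * ?d x)"
    using L2_integrable_product[OF W g]
    by (intro complex_cond_exp_integral_mult pg) (simp_all add: weighted_cond_op_def mult_ac)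
  also have "\<dots> = (LINT x|M. ?d x * ?e x)"
    by (simp add: mult.commute)
  also have "\<dots> = (LINT x|M. ?d x * (r x * f x))"
    using L2_integrable_product[OF f V] unfolding dV
    by (intro complex_cond_exp_integral_mult[symmetric] rf) (simp_all add: mult_ac)
  also have "\<dots> = L2_inner M f (?V g)"
    unfolding L2_inner_def dV by (simp add: mult_ac)
  finally show ?thesis .
qed

end

section \<open>Centered weighted conditional operators\<close>

context sigma_finite_subalgebra
begin

text \<open>
  The case of equality in the Cauchy-Schwarz inequality, localized to the set where the conditional
  expectation \<open>q\<close> of \<open>u w\<close> does not vanish.  The factor is \<open>c = q / E|w|\<^sup>2\<close>: there, the difference
  \<open>u - c cnj w\<close> has second moment zero.  It satisfies \<open>q cnj c = cnj q c\<close> since \<open>c\<close> is a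
  real multiple of \<open>q\<close>.
\<close>

lemma cond_collinear:
  assumes u: "u \<in> cond_L2" and w: "w \<in> cond_L2"
    and eq: "AE x in M. CE (\<lambda>y. u y * w y) x \<noteq> 0 \<longrightarrow>
      (cmod (CE (\<lambda>y. u y * w y) x))\<^sup>2 = second_moment u x * second_moment w x"
  obtains c where "c \<in> borel_measurable F"
    "AE x in M. CE (\<lambda>y. u y * w y) x \<noteq> 0 \<longrightarrow> u x = c x * cnj (w x)"
    "AE x in M. CE (\<lambda>y. u y * w y) x * cnj (c x) = cnj (CE (\<lambda>y. u y * w y) x) * c x"
proof
  let ?q = "CE (\<lambda>y. u y * w y)"
  define c where "c x = ?q x / of_real (second_moment w x)" for x
  show c: "c \<in> borel_measurable F"
    unfolding c_def[abs_def] by (intro borel_measurable_divide complex_cond_exp_measurable_F) measurable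
  have "(\<lambda>x. - c x * cnj (w x)) \<in> cond_L2"
    using c by (intro cond_L2_mult cnj_cond_L2 w) measurable
  from cond_L2_add[OF u this] have v: "(\<lambda>x. u x - c x * cnj (w x)) \<in> cond_L2" by simp
  show "AE x in M. ?q x \<noteq> 0 \<longrightarrow> u x = c x * cnj (w x)"
    using second_moment_diff[OF u w c] second_moment_eq_0_imp_zero[OF v] eq
  proof eventually_elim
    case (elim x)
    show ?case
    proof
      assume q: "?q x \<noteq> 0"
      with elim(3) have ab: "(cmod (?q x))\<^sup>2 = second_moment u x * second_moment w x" by simp
      with q have b: "second_moment w x \<noteq> 0" by auto
      have "cnj (c x) * ?q x = of_real ((cmod (?q x))\<^sup>2 / second_moment w x)"
        by (simp add: c_def complex_norm_square mult.commute del: of_real_power)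
      then have "Re (cnj (c x) * ?q x) = second_moment u x"
        unfolding ab using b by simp
      moreover have "(cmod (c x))\<^sup>2 * second_moment w x = second_moment u x"
        using b by (simp only: c_def norm_divide power_divide ab) (simp add: power2_eq_square)
      ultimately have "second_moment (\<lambda>x. u x - c x * cnj (w x)) x = 0"
        unfolding elim(1) by simp
      with elim(2) show "u x = c x * cnj (w x)" by simp
    qed
  qed
  show "AE x in M. ?q x * cnj (c x) = cnj (?q x) * c x"
    by (simp add: c_def)
qed

text \<open>
  The condition on the left, which says that the two kinds of products of \<open>f \<mapsto> w E(u f)\<close> with its
  adjoint commute, amounts to equality in the Cauchy-Schwarz inequality where the conditional
  expectation of \<open>u w\<close> does not vanish.  From left to right, the test function is \<open>cnj u\<close> with a
  positive weight; from right to left, \<open>u\<close> is there a multiple of \<open>cnj w\<close>.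
\<close>

lemma intertwining_iff:
  assumes u: "u \<in> cond_L2" and w: "w \<in> cond_L2"
  shows "(\<forall>f\<in>L2_space M. AE x in M.
      CE (\<lambda>y. u y * w y) x * weighted_cond_op M F (\<lambda>x. cnj (u x)) (\<lambda>x. cnj (w x)) f x
      = cnj (CE (\<lambda>y. u y * w y) x) * weighted_cond_op M F w u f x)
    \<longleftrightarrow> (AE x in M. CE (\<lambda>y. u y * w y) x \<noteq> 0 \<longrightarrow>
      (cmod (CE (\<lambda>y. u y * w y) x))\<^sup>2 = second_moment u x * second_moment w x)"
proof (intro iffI ballI)
  let ?q = "CE (\<lambda>y. u y * w y)" and ?a = "second_moment u" and ?b = "second_moment w"
  note [measurable] = cond_L2_measurable[OF u] cond_L2_measurable[OF w]
  have qF[measurable]: "?q \<in> borel_measurable F" by (rule complex_cond_exp_measurable_F)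
  define h :: "'a \<Rightarrow> complex" where "h x = (if ?q x = 0 then 0 else 1)" for x
  have h[measurable]: "h \<in> borel_measurable F"
    unfolding h_def[abs_def] by measurable
  have hM[measurable]: "h \<in> borel_measurable M" by (rule measurable_lift[OF h])
  note cu = cnj_cond_L2[OF u] and cw = cnj_cond_L2[OF w]
  {
    assume *: "\<forall>f\<in>L2_space M. AE x in M.
      ?q x * weighted_cond_op M F (\<lambda>x. cnj (u x)) (\<lambda>x. cnj (w x)) f x = cnj (?q x) * weighted_cond_op M F w u f x"
    obtain \<psi> :: "'a \<Rightarrow> real" where \<psi>: "\<psi> \<in> borel_measurable F" "AE x in M. 0 < \<psi> x"
      and f: "(\<lambda>x. of_real (\<psi> x) * cnj (u x)) \<in> L2_space M"
      using ex_positive_weight_L2[OF cu] by auto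
    note [measurable] = \<psi>(1)
    let ?f = "\<lambda>x. of_real (\<psi> x) * cnj (u x)"
    have cnj_q: "CE (\<lambda>y. cnj (w y) * cnj (u y)) = (\<lambda>x. cnj (?q x))"
      using complex_cond_exp_cnj[of "\<lambda>y. u y * w y"] by (simp add: mult.commute)
    have "AE x in M. CE (\<lambda>y. of_real (\<psi> y) * (cnj (w y) * cnj (u y))) x
        = of_real (\<psi> x) * CE (\<lambda>y. cnj (w y) * cnj (u y)) x"
      by (intro complex_cond_exp_mult cond_L2_product_in_domain cu cw) measurable
    moreover have "AE x in M. CE (\<lambda>y. of_real (\<psi> y) * (u y * cnj (u y))) x
        = of_real (\<psi> x) * CE (\<lambda>y. u y * cnj (u y)) x"
      by (intro complex_cond_exp_mult cond_L2_product_in_domain u cu) measurable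
    moreover have "AE x in M. ?q x * weighted_cond_op M F (\<lambda>x. cnj (u x)) (\<lambda>x. cnj (w x)) ?f x
        = cnj (?q x) * weighted_cond_op M F w u ?f x"
      using * f by blast
    moreover note \<psi>(2) complex_cond_exp_norm_square[OF cond_L2_measurable[OF u]]
    ultimately have "AE x in M. (h x * ?q x) * cnj (u x * w x) = (h x * of_real (?a x)) * (w x * cnj (w x))"
    proof eventually_elim
      case (elim x)
      have "CE (\<lambda>y. cnj (w y) * ?f y) x = of_real (\<psi> x) * cnj (?q x)"
        using elim(1) unfolding cnj_q by (simp add: mult_ac)
      moreover have "CE (\<lambda>y. u y * ?f y) x = of_real (\<psi> x) * of_real (?a x)"
        using elim(2,5) by (simp add: mult_ac)
      ultimately have "of_real (\<psi> x) * cnj (?q x) * (?q x * cnj (u x))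
          = of_real (\<psi> x) * cnj (?q x) * (of_real (?a x) * w x)"
        using elim(3) by (simp add: weighted_cond_op_def mult_ac)
      then have "?q x \<noteq> 0 \<longrightarrow> ?q x * cnj (u x) = of_real (?a x) * w x"
        using elim(4) by auto
      then show ?case
        by (auto simp: h_def mult_ac)
    qed
    then have "AE x in M. CE (\<lambda>x. (h x * ?q x) * cnj (u x * w x)) x
        = CE (\<lambda>x. (h x * of_real (?a x)) * (w x * cnj (w x))) x"
      by (intro complex_cond_exp_cong) measurable
    moreover have "AE x in M. CE (\<lambda>x. (h x * ?q x) * cnj (u x * w x)) x
        = (h x * ?q x) * CE (\<lambda>x. cnj (u x * w x)) x"
      using cond_L2_product_in_domain[OF cu cw] by (intro complex_cond_exp_mult) simp_all
    moreover have "AE x in M. CE (\<lambda>x. (h x * of_real (?a x)) * (w x * cnj (w x))) x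
        = (h x * of_real (?a x)) * CE (\<lambda>x. w x * cnj (w x)) x"
      by (intro complex_cond_exp_mult cond_L2_product_in_domain w cw) measurable
    moreover note complex_cond_exp_norm_square[OF cond_L2_measurable[OF w]]
    ultimately show "AE x in M. ?q x \<noteq> 0 \<longrightarrow> (cmod (?q x))\<^sup>2 = ?a x * ?b x"
    proof eventually_elim
      case (elim x)
      then have "(h x * ?q x) * cnj (?q x) = (h x * of_real (?a x)) * of_real (?b x)"
        unfolding complex_cond_exp_cnj by auto
      then have "h x * (?q x * cnj (?q x)) = h x * of_real (?a x * ?b x)"
        by (simp add: mult_ac)
      then show ?case
        unfolding complex_norm_square[symmetric] by (simp add: h_def split: if_splits del: of_real_power of_real_mult)
    qed
  }
  fix f assume eq: "AE x in M. ?q x \<noteq> 0 \<longrightarrow> (cmod (?q x))\<^sup>2 = ?a x * ?b x"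
    and f: "f \<in> L2_space M"
  note [measurable] = L2_space_measurable[OF f]
  obtain c where c: "c \<in> borel_measurable F"
    and uc: "AE x in M. ?q x \<noteq> 0 \<longrightarrow> u x = c x * cnj (w x)"
    and qc: "AE x in M. ?q x * cnj (c x) = cnj (?q x) * c x"
    by (rule cond_collinear[OF u w eq])
  note [measurable] = c measurable_lift[OF c]
  have f': "f \<in> cond_L2" by (rule L2_space_subset_cond_L2[OF f])
  have "AE x in M. CE (\<lambda>x. h x * (u x * f x)) x = CE (\<lambda>x. (h x * c x) * (cnj (w x) * f x)) x"
  proof (rule complex_cond_exp_cong)
    show "AE x in M. h x * (u x * f x) = (h x * c x) * (cnj (w x) * f x)"
      using uc by eventually_elim (simp add: h_def)
  qed measurable
  moreover have "AE x in M. CE (\<lambda>x. h x * (u x * f x)) x = h x * CE (\<lambda>x. u x * f x) x"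
    by (intro complex_cond_exp_mult cond_L2_product_in_domain u f' h)
  moreover have "AE x in M. CE (\<lambda>x. (h x * c x) * (cnj (w x) * f x)) x = (h x * c x) * CE (\<lambda>x. cnj (w x) * f x) x"
    by (intro complex_cond_exp_mult cond_L2_product_in_domain cw f') measurable
  moreover note uc qc
  ultimately show "AE x in M. ?q x * weighted_cond_op M F (\<lambda>x. cnj (u x)) (\<lambda>x. cnj (w x)) f x
      = cnj (?q x) * weighted_cond_op M F w u f x"
  proof eventually_elim
    case (elim x)
    show ?case
    proof (cases "?q x = 0")
      case False
      let ?e = "CE (\<lambda>x. cnj (w x) * f x) x"
      from elim(1-3) False have ef: "CE (\<lambda>x. u x * f x) x = c x * ?e"
        by (simp add: h_def)
      have "?q x * (cnj (u x) * ?e) = (?q x * cnj (c x)) * w x * ?e"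
        using elim(4) False by simp
      also have "\<dots> = cnj (?q x) * (w x * CE (\<lambda>x. u x * f x) x)"
        unfolding elim(5) ef by simp
      finally show ?thesis
        by (simp add: weighted_cond_op_def)
    qed simp
  qed
qed

text \<open>
  The operator \<open>R\<close> is only required to agree with the weighted conditional operator up to null sets.
  This admits modifications of the weights that do not change the operator.
\<close>

theorem centered_iff:
  assumes u: "u \<in> cond_L2" and w: "w \<in> cond_L2"
    and K: "AE x in M. second_moment u x * second_moment w x \<le> K"
    and R: "L2_bounded_operator M R"
      "\<And>f. f \<in> L2_space M \<Longrightarrow> ae_equal M (R f) (weighted_cond_op M F w u f)"
  shows "L2_centered M R \<longleftrightarrow> (AE x in M. CE (\<lambda>y. u y * w y) x \<noteq> 0 \<longrightarrow>
      (cmod (CE (\<lambda>y. u y * w y) x))\<^sup>2 = second_moment u x * second_moment w x)"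
proof -
  note [measurable] = cond_L2_measurable[OF u] cond_L2_measurable[OF w]
  let ?q = "CE (\<lambda>y. u y * w y)" and ?a = "second_moment u" and ?b = "second_moment w"
  let ?u' = "\<lambda>x. cnj (u x)" and ?w' = "\<lambda>x. cnj (w x)"
  let ?V = "weighted_cond_op M F ?u' ?w'"
  let ?R' = "L2_adjoint M R"
  note cu = cnj_cond_L2[OF u] and cw = cnj_cond_L2[OF w]
  have Ku: "AE x in M. second_moment w x * second_moment u x \<le> K"
    and Kc: "AE x in M. second_moment ?u' x * second_moment ?w' x \<le> K"
    using K by (simp_all add: second_moment_cnj mult.commute)
  have V: "L2_bounded_operator M ?V"
    by (rule weighted_cond_op_bounded[OF cu cw Kc])
  have "L2_inner M (R f) g = L2_inner M f (?V g)" if f: "f \<in> L2_space M" and g: "g \<in> L2_space M" for f g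
  proof -
    have "R f \<in> L2_space M" using R(1) f by (simp add: L2_bounded_operator_def)
    then have "L2_inner M (R f) g = L2_inner M (weighted_cond_op M F w u f) g"
      using R(2)[OF f] g by (intro L2_inner_cong) (auto intro: L2_space_measurable)
    also have "\<dots> = L2_inner M f (?V g)"
      by (rule weighted_cond_op_adjoint[OF w u f g Ku])
    finally show ?thesis .
  qed
  note R' = L2_adjoint_unique[OF V this]
  have rep: "represented_by R (\<lambda>_. 1) w u" "represented_by ?R' (\<lambda>_. 1) ?u' ?w'"
    using R R' u w cu cw by (auto simp: represented_by_def scaled_cond_op_def L2_bounded_operator_def)
  have q': "CE (\<lambda>y. ?w' y * ?u' y) x = cnj (?q x)" for x
    using fun_cong[OF complex_cond_exp_cnj[of "\<lambda>y. u y * w y"], of x] by (simp add: mult.commute)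
  define P where "P n = ?R' ^^ n \<circ> R ^^ n" for n
  define Q where "Q n = R ^^ n \<circ> ?R' ^^ n" for n
  define \<alpha> where "\<alpha> n x = cnj (?q x) ^ n * ?q x ^ n * CE (\<lambda>y. ?w' y * w y) x" for n x
  define \<beta> where "\<beta> n x = ?q x ^ n * cnj (?q x) ^ n * CE (\<lambda>y. u y * ?u' y) x" for n x
  have P: "represented_by (P (Suc n)) (\<alpha> n) ?u' u" for n
    using represented_by_comp[OF represented_by_funpow[OF rep(2)] represented_by_funpow[OF rep(1)], of n n]
    by (simp only: P_def \<alpha>_def[abs_def] q')
  have Q: "represented_by (Q (Suc n)) (\<beta> n) w ?w'" for n
    using represented_by_comp[OF represented_by_funpow[OF rep(1)] represented_by_funpow[OF rep(2)], of n n]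
    by (simp only: Q_def \<beta>_def[abs_def] q')
  define commute where "commute X Y \<longleftrightarrow> (\<forall>f\<in>L2_space M. ae_equal M (X (Y f)) (Y (X f)))"
    for X Y :: "('a \<Rightarrow> complex) \<Rightarrow> 'a \<Rightarrow> complex"
  have PQ: "commute (P (Suc n)) (Q (Suc m)) \<longleftrightarrow> (\<forall>f\<in>L2_space M. AE x in M.
      \<alpha> n x * \<beta> m x * (?q x * ?V f x) = \<alpha> n x * \<beta> m x * (cnj (?q x) * weighted_cond_op M F w u f x))" for n m
    unfolding commute_def using represented_by_commute_iff[OF P Q] by (simp add: q')
  have PP: "commute (P (Suc n)) (P (Suc m))" for n m
    unfolding commute_def using represented_by_commute_iff[OF P P] by simp
  have QQ: "commute (Q (Suc n)) (Q (Suc m))" for n m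
    unfolding commute_def using represented_by_commute_iff[OF Q Q] by simp
  have sym: "commute X Y \<Longrightarrow> commute Y X" for X Y
    unfolding commute_def ae_equal_def by (auto elim!: AE_mp)
  have id: "commute id X" "commute X id" for X
    by (simp_all add: commute_def ae_equal_def)
  have 0: "P 0 = id" "Q 0 = id" by (simp_all add: P_def Q_def)
  have "L2_centered M R \<longleftrightarrow> (\<forall>X\<in>range P \<union> range Q. \<forall>Y\<in>range P \<union> range Q. commute X Y)"
    using R(1) unfolding L2_centered_def Let_def commute_def P_def[abs_def] Q_def[abs_def] by simp
  also have "\<dots> \<longleftrightarrow> (\<forall>n m. commute (P (Suc n)) (Q (Suc m)))"
  proof (intro iffI ballI allI)
    fix X Y assume *: "\<forall>n m. commute (P (Suc n)) (Q (Suc m))"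
    assume "X \<in> range P \<union> range Q" "Y \<in> range P \<union> range Q"
    moreover have "Z = id \<or> (\<exists>n. Z = P (Suc n)) \<or> (\<exists>n. Z = Q (Suc n))" if "Z \<in> range P \<union> range Q" for Z
      using that 0 by (metis UnE imageE not0_implies_Suc)
    ultimately show "commute X Y"
      using * PP QQ sym id by metis
  qed auto
  also have "\<dots> \<longleftrightarrow> (\<forall>f\<in>L2_space M. AE x in M. ?q x * ?V f x = cnj (?q x) * weighted_cond_op M F w u f x)"
  proof (intro iffI allI)
    fix n m
    assume "\<forall>f\<in>L2_space M. AE x in M. ?q x * ?V f x = cnj (?q x) * weighted_cond_op M F w u f x"
    then show "commute (P (Suc n)) (Q (Suc m))"
      unfolding PQ by (auto elim!: ballE AE_mp)
  next
    assume "\<forall>n m. commute (P (Suc n)) (Q (Suc m))"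
    then have *: "commute (P (Suc 0)) (Q (Suc 0))" by blast
    \<comment> \<open>The scalar in front of the products of the first powers can be cancelled where \<open>q\<close> does not
      vanish, by Cauchy-Schwarz.\<close>
    have "AE x in M. CE (\<lambda>y. ?w' y * w y) x = of_real (?b x)"
      using complex_cond_exp_norm_square[OF cond_L2_measurable[OF w]] by (simp add: mult.commute)
    moreover note complex_cond_exp_norm_square[OF cond_L2_measurable[OF u]] cond_Cauchy_Schwarz[OF u w]
    ultimately have ab: "AE x in M. ?q x \<noteq> 0 \<longrightarrow> \<alpha> 0 x * \<beta> 0 x \<noteq> 0"
    proof eventually_elim
      case (elim x)
      have "?a x * ?b x > 0" if "?q x \<noteq> 0"
        using elim(3) that by (meson less_le_trans zero_less_norm_iff zero_less_power)
      then show ?case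
        using elim(1,2) by (auto simp: \<alpha>_def \<beta>_def)
    qed
    show "\<forall>f\<in>L2_space M. AE x in M. ?q x * ?V f x = cnj (?q x) * weighted_cond_op M F w u f x"
    proof
      fix f assume "f \<in> L2_space M"
      with * have "AE x in M. \<alpha> 0 x * \<beta> 0 x * (?q x * ?V f x)
          = \<alpha> 0 x * \<beta> 0 x * (cnj (?q x) * weighted_cond_op M F w u f x)"
        unfolding PQ by blast
      with ab show "AE x in M. ?q x * ?V f x = cnj (?q x) * weighted_cond_op M F w u f x"
        by eventually_elim auto
    qed
  qed
  also have "\<dots> \<longleftrightarrow> (AE x in M. ?q x \<noteq> 0 \<longrightarrow> (cmod (?q x))\<^sup>2 = ?a x * ?b x)"
    by (rule intertwining_iff[OF u w])
  finally show ?thesis .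
qed

end

section \<open>Necessity of bounded second moments\<close>

context sigma_finite_subalgebra
begin

text \<open>
  The function \<open>t\<close> stands for a truncation of \<open>u\<close>, which makes its second moment finite.  For
  \<open>f = \<eta> cnj t\<close> the squared norms of \<open>f\<close> and of its image are the integrals of \<open>k = \<eta>\<^sup>2 E|t|\<^sup>2\<close> and
  of \<open>k E|t|\<^sup>2 E|w|\<^sup>2\<close>.  If the weight \<open>\<eta>\<close> is supported where \<open>E|t|\<^sup>2 E|w|\<^sup>2 > C\<^sup>2\<close>, the bound on the
  operator forces \<open>k\<close> to vanish, so this set is null.
\<close>

lemma bounded_imp_truncated_moment_le:
  assumes u: "u \<in> borel_measurable M" and w: "w \<in> borel_measurable M"
    and t: "t \<in> cond_L2" "AE x in M. u x * cnj (t x) = t x * cnj (t x)"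
    and C: "\<And>f. f \<in> L2_space M \<Longrightarrow> weighted_cond_op M F w u f \<in> L2_space M"
      "\<And>f. f \<in> L2_space M \<Longrightarrow> L2_norm M (weighted_cond_op M F w u f) \<le> C * L2_norm M f"
  shows "AE x in M. nn_cond_exp_sq M F t x * nn_cond_exp_sq M F w x \<le> ennreal (C\<^sup>2)"
proof -
  note [measurable] = u w cond_L2_measurable[OF t(1)]
  let ?a = "second_moment t" and ?b = "nn_cond_exp_sq M F w"
  obtain \<psi> :: "'a \<Rightarrow> real" where \<psi>[measurable]: "\<psi> \<in> borel_measurable F" and \<psi>_pos: "AE x in M. 0 < \<psi> x"
    and \<psi>t: "(\<lambda>x. of_real (\<psi> x) * t x) \<in> L2_space M"
    using ex_positive_weight_L2[OF t(1)] by auto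
  define \<eta> where "\<eta> x = (if ennreal (?a x) * ?b x \<le> ennreal (C\<^sup>2) then 0 else \<psi> x)" for x
  have \<eta>F[measurable]: "\<eta> \<in> borel_measurable F"
    unfolding \<eta>_def[abs_def] by measurable
  have [measurable]: "\<eta> \<in> borel_measurable M" by (rule measurable_lift[OF \<eta>F])
  let ?f = "\<lambda>x. of_real (\<eta> x) * cnj (t x)"
  have f: "?f \<in> L2_space M"
  proof (rule L2_space_dominated[OF _ \<psi>t])
    show "?f \<in> borel_measurable M" by measurable
  qed (simp add: \<eta>_def norm_mult)
  let ?k = "\<lambda>x. ennreal ((\<eta> x)\<^sup>2 * ?a x)"
  have norm_f: "ennreal ((L2_norm M ?f)\<^sup>2) = (\<integral>\<^sup>+x. ?k x \<partial>M)"
  proof -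
    have "ennreal ((L2_norm M ?f)\<^sup>2) = (\<integral>\<^sup>+x. ennreal ((\<eta> x)\<^sup>2) * ennreal ((cmod (t x))\<^sup>2) \<partial>M)"
      unfolding L2_norm_sq[OF f] by (simp add: norm_mult power_mult_distrib ennreal_mult)
    also have "\<dots> = (\<integral>\<^sup>+x. ennreal ((\<eta> x)\<^sup>2) * nn_cond_exp_sq M F t x \<partial>M)"
      unfolding nn_cond_exp_sq_def by (intro nn_cond_exp_intg[symmetric]) auto
    also have "\<dots> = (\<integral>\<^sup>+x. ?k x \<partial>M)"
      using ennreal_second_moment[OF t(1)]
      by (intro nn_integral_cong_AE) (auto simp: ennreal_mult)
    finally show ?thesis .
  qed
  have uf: "AE x in M. CE (\<lambda>y. u y * ?f y) x = of_real (\<eta> x * ?a x)"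
  proof -
    have "AE x in M. CE (\<lambda>y. u y * ?f y) x = CE (\<lambda>y. of_real (\<eta> y) * (t y * cnj (t y))) x"
      using t(2) by (intro complex_cond_exp_cong) (auto simp: mult_ac)
    moreover have "AE x in M. CE (\<lambda>y. of_real (\<eta> y) * (t y * cnj (t y))) x = of_real (\<eta> x) * CE (\<lambda>y. t y * cnj (t y)) x"
      by (intro complex_cond_exp_mult cond_L2_product_in_domain t(1) cnj_cond_L2) measurable
    moreover note complex_cond_exp_norm_square[OF cond_L2_measurable[OF t(1)]]
    ultimately show ?thesis by eventually_elim simp
  qed
  have norm_Tf: "ennreal ((L2_norm M (weighted_cond_op M F w u ?f))\<^sup>2) = (\<integral>\<^sup>+x. ?k x * (ennreal (?a x) * ?b x) \<partial>M)"
  proof -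
    have "ennreal ((L2_norm M (weighted_cond_op M F w u ?f))\<^sup>2)
        = (\<integral>\<^sup>+x. ennreal ((\<eta> x * ?a x)\<^sup>2) * ennreal ((cmod (w x))\<^sup>2) \<partial>M)"
      unfolding L2_norm_sq[OF C(1)[OF f]]
    proof (rule nn_integral_cong_AE)
      show "AE x in M. ennreal ((cmod (weighted_cond_op M F w u ?f x))\<^sup>2)
          = ennreal ((\<eta> x * ?a x)\<^sup>2) * ennreal ((cmod (w x))\<^sup>2)"
        using uf
      proof eventually_elim
        case (elim x)
        show ?case
          unfolding weighted_cond_op_def elim norm_mult norm_of_real power_mult_distrib
          by (simp add: ennreal_mult mult_ac power_mult_distrib)
      qed
    qed
    also have "\<dots> = (\<integral>\<^sup>+x. ennreal ((\<eta> x * ?a x)\<^sup>2) * ?b x \<partial>M)"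
      unfolding nn_cond_exp_sq_def by (intro nn_cond_exp_intg[symmetric]) auto
    also have "\<dots> = (\<integral>\<^sup>+x. ?k x * (ennreal (?a x) * ?b x) \<partial>M)"
    proof (intro nn_integral_cong)
      fix x
      have "ennreal ((\<eta> x * ?a x)\<^sup>2) = ?k x * ennreal (?a x)"
        by (subst ennreal_mult''[symmetric]) (auto simp: power2_eq_square mult_ac)
      then show "ennreal ((\<eta> x * ?a x)\<^sup>2) * ?b x = ?k x * (ennreal (?a x) * ?b x)"
        by (simp only: mult.assoc)
    qed
    finally show ?thesis .
  qed
  have le: "?k x * ennreal (C\<^sup>2) \<le> ?k x * (ennreal (?a x) * ?b x)" for x
    by (cases "ennreal (?a x) * ?b x \<le> ennreal (C\<^sup>2)") (auto simp: \<eta>_def intro!: mult_left_mono)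
  have fin: "(\<integral>\<^sup>+x. ?k x * ennreal (C\<^sup>2) \<partial>M) < \<infinity>"
    unfolding nn_integral_multc[of ?k M "ennreal (C\<^sup>2)", simplified] norm_f[symmetric] by (simp add: ennreal_mult_less_top)
  have "(\<integral>\<^sup>+x. ?k x * (ennreal (?a x) * ?b x) \<partial>M) \<le> (\<integral>\<^sup>+x. ?k x * ennreal (C\<^sup>2) \<partial>M)"
  proof -
    have "(L2_norm M (weighted_cond_op M F w u ?f))\<^sup>2 \<le> (C * L2_norm M ?f)\<^sup>2"
      using C(2)[OF f] by (intro power_mono) (simp_all add: L2_norm_def)
    then have "(\<integral>\<^sup>+x. ?k x * (ennreal (?a x) * ?b x) \<partial>M) \<le> ennreal ((L2_norm M ?f)\<^sup>2 * C\<^sup>2)"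
      unfolding norm_Tf[symmetric] by (intro ennreal_leI) (simp add: power_mult_distrib mult.commute)
    also have "\<dots> = (\<integral>\<^sup>+x. ?k x * ennreal (C\<^sup>2) \<partial>M)"
      by (simp add: ennreal_mult norm_f nn_integral_multc)
    finally show ?thesis .
  qed
  then have "(\<integral>\<^sup>+x. ?k x * (ennreal (?a x) * ?b x) - ?k x * ennreal (C\<^sup>2) \<partial>M) = 0"
    using fin le by (subst nn_integral_diff) (auto simp: diff_eq_0_iff_ennreal top_unique less_top[symmetric])
  then have "AE x in M. ?k x * (ennreal (?a x) * ?b x) - ?k x * ennreal (C\<^sup>2) = 0"
    by (simp add: nn_integral_0_iff_AE)
  with \<psi>_pos ennreal_second_moment[OF t(1)] show ?thesis
  proof eventually_elim
    case (elim x)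
    show ?case
    proof (rule ccontr)
      assume "\<not> nn_cond_exp_sq M F t x * ?b x \<le> ennreal (C\<^sup>2)"
      then have n: "\<not> ennreal (?a x) * ?b x \<le> ennreal (C\<^sup>2)"
        unfolding elim(2) .
      then have "?a x \<noteq> 0" by auto
      then have "?a x > 0" using second_moment_nonneg[of t x] by linarith
      with n elim(1) have "?k x \<noteq> 0" by (simp add: \<eta>_def)
      moreover have "?k x * (ennreal (?a x) * ?b x) \<le> ?k x * ennreal (C\<^sup>2)"
        using elim(3) by (rule ennreal_minus_eq_0)
      ultimately show False
        using n ennreal_mult_le_mult_iff[of "?k x"] by simp
    qed
  qed
qed

text \<open>
  Truncate \<open>u\<close> at the levels \<open>n\<close> and pass to the limit by monotone convergence; the bound does not
  depend on \<open>n\<close>.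
\<close>

lemma bounded_imp_moment_product_le:
  assumes u: "u \<in> borel_measurable M" and w: "w \<in> borel_measurable M"
    and T: "L2_bounded_operator M (weighted_cond_op M F w u)"
  obtains K where "0 \<le> K" "AE x in M. nn_cond_exp_sq M F u x * nn_cond_exp_sq M F w x \<le> ennreal K"
proof -
  note [measurable] = u w
  obtain C where C: "\<And>f. f \<in> L2_space M \<Longrightarrow> L2_norm M (weighted_cond_op M F w u f) \<le> C * L2_norm M f"
    using T unfolding L2_bounded_operator_def by blast
  have maps: "weighted_cond_op M F w u f \<in> L2_space M" if "f \<in> L2_space M" for f
    using T that by (simp add: L2_bounded_operator_def)
  define t where "t n x = (if cmod (u x) \<le> real n then u x else 0)" for n x
  have t[measurable]: "t n \<in> borel_measurable M" for n
    unfolding t_def[abs_def] by measurable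
  have tL: "t n \<in> cond_L2" for n
  proof -
    have "AE x in M. nn_cond_exp_sq M F (t n) x \<le> NE (\<lambda>_. ennreal ((real n)\<^sup>2)) x"
      unfolding nn_cond_exp_sq_def
      by (intro nn_cond_exp_mono) (auto simp: t_def intro!: ennreal_leI power_mono)
    moreover have "AE x in M. ennreal ((real n)\<^sup>2) = NE (\<lambda>_. ennreal ((real n)\<^sup>2)) x"
      by (intro nn_cond_exp_F_meas) auto
    ultimately have "AE x in M. nn_cond_exp_sq M F (t n) x < \<infinity>"
    proof eventually_elim
      case (elim x)
      show ?case
        using elim(1) unfolding elim(2)[symmetric] by (rule order.strict_trans1) simp
    qed
    then show ?thesis by (simp add: cond_L2_def)
  qed
  have "AE x in M. nn_cond_exp_sq M F (t n) x * nn_cond_exp_sq M F w x \<le> ennreal (C\<^sup>2)" for n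
    by (rule bounded_imp_truncated_moment_le[OF u w tL _ maps C]) (auto simp: t_def)
  then have "AE x in M. \<forall>n. nn_cond_exp_sq M F (t n) x * nn_cond_exp_sq M F w x \<le> ennreal (C\<^sup>2)"
    by (simp add: AE_all_countable)
  moreover have "AE x in M. nn_cond_exp_sq M F u x = (SUP n. nn_cond_exp_sq M F (t n) x)"
  proof -
    have "(\<lambda>x. ennreal ((cmod (u x))\<^sup>2)) = (\<lambda>x. SUP n. ennreal ((cmod (t n x))\<^sup>2))"
    proof (intro ext antisym)
      fix x
      show "(SUP n. ennreal ((cmod (t n x))\<^sup>2)) \<le> ennreal ((cmod (u x))\<^sup>2)"
        by (intro SUP_least) (auto simp: t_def)
      have "cmod (u x) \<le> real (nat \<lceil>cmod (u x)\<rceil>)" by linarith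
      then show "ennreal ((cmod (u x))\<^sup>2) \<le> (SUP n. ennreal ((cmod (t n x))\<^sup>2))"
        by (intro SUP_upper2[of "nat \<lceil>cmod (u x)\<rceil>"]) (auto simp: t_def)
    qed
    moreover have "incseq (\<lambda>n x. ennreal ((cmod (t n x))\<^sup>2))"
      by (intro incseq_SucI le_funI) (auto simp: t_def)
    ultimately show ?thesis
      using nn_cond_exp_SUP[of "\<lambda>n x. ennreal ((cmod (t n x))\<^sup>2)"] by (simp add: nn_cond_exp_sq_def)
  qed
  ultimately have "AE x in M. nn_cond_exp_sq M F u x * nn_cond_exp_sq M F w x \<le> ennreal (C\<^sup>2)"
    by eventually_elim (auto simp: SUP_mult_right_ennreal intro!: SUP_least)
  then show thesis by (rule that[rotated]) simp
qed

text \<open>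
  A bound on the product of the second moments leaves each of them free to be infinite where the
  other one vanishes.  Cutting \<open>f\<close> off there makes its second moment finite.
\<close>

lemma restricted_second_moment:
  assumes f: "f \<in> borel_measurable M" and g: "g \<in> borel_measurable M"
    and fin: "AE x in M. nn_cond_exp_sq M F f x * nn_cond_exp_sq M F g x < \<infinity>"
  defines "f' \<equiv> \<lambda>x. if nn_cond_exp_sq M F g x = 0 then 0 else f x"
  shows "AE x in M. nn_cond_exp_sq M F f' x = (if nn_cond_exp_sq M F g x = 0 then 0 else nn_cond_exp_sq M F f x)"
    and "f' \<in> cond_L2"
proof -
  note [measurable] = f g
  define h :: "'a \<Rightarrow> complex" where "h x = (if nn_cond_exp_sq M F g x = 0 then 0 else 1)" for x
  have h: "h \<in> borel_measurable F"
    unfolding h_def[abs_def] by measurable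
  have "f' = (\<lambda>x. h x * f x)" by (auto simp: f'_def h_def)
  then show *: "AE x in M. nn_cond_exp_sq M F f' x = (if nn_cond_exp_sq M F g x = 0 then 0 else nn_cond_exp_sq M F f x)"
    using nn_cond_exp_sq_mult[OF h f] by (auto simp: h_def elim!: AE_mp)
  have "f' \<in> borel_measurable M"
    unfolding f'_def by measurable
  moreover have "AE x in M. nn_cond_exp_sq M F f' x < \<infinity>"
    using * fin by eventually_elim (auto simp: ennreal_mult_less_top)
  ultimately show "f' \<in> cond_L2"
    by (simp add: cond_L2_def)
qed

end

theorem corollary2p6:
  fixes M F :: "'a measure" and u w :: "'a \<Rightarrow> complex" and S G H :: "'a set"
  assumes "complete_measure M"
    and "sigma_finite_measure M"
    and "sigma_finite_subalgebra M F"
    and "u \<in> cond_exp_domain M F"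
    and "w \<in> cond_exp_domain M F"
    and "bounded_weighted_cond_op M F w u"
    and "S = supp_set M (nn_cond_exp_sq M F u)"
    and "G = supp_set M (nn_cond_exp_sq M F w)"
    and "H = supp_set M (complex_cond_exp M F (\<lambda>x. u x * w x))"
    and "ae_equal_sets M
           (supp_set M (\<lambda>x. complex_cond_exp M F u x * complex_cond_exp M F w x)) (S \<inter> G)"
    and "ae_equal_sets M (S \<inter> G) H"
  shows "L2_centered M (weighted_cond_op M F w u) \<longleftrightarrow>
    ae_equal M
      (\<lambda>x. ennreal ((cmod (complex_cond_exp M F (\<lambda>y. u y * w y) x))\<^sup>2))
      (\<lambda>x. nn_cond_exp_sq M F u x * nn_cond_exp_sq M F w x)"
proof -
  interpret sigma_finite_subalgebra M F by (rule assms(3))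
  let ?W = "weighted_cond_op M F w u"
  let ?a = "nn_cond_exp_sq M F u" and ?b = "nn_cond_exp_sq M F w"
  let ?q = "CE (\<lambda>y. u y * w y)"
  have u[measurable]: "u \<in> borel_measurable M" and w[measurable]: "w \<in> borel_measurable M"
    using assms(4,5) by (auto simp: cond_exp_domain_def)
  have W: "L2_bounded_operator M ?W"
    and dom: "\<And>f. f \<in> L2_space M \<Longrightarrow> (\<lambda>x. u x * f x) \<in> cond_exp_domain M F"
    using assms(6) by (auto simp: bounded_weighted_cond_op_def)
  have supports: "AE x in M. ?a x * ?b x \<noteq> 0 \<longleftrightarrow> ?q x \<noteq> 0"
    using assms(11) AE_space unfolding assms(7-9) ae_equal_sets_def supp_set_def by eventually_elim auto
  obtain K where K: "0 \<le> K" "AE x in M. ?a x * ?b x \<le> ennreal K"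
    using bounded_imp_moment_product_le[OF u w W] by blast
  from K(2) have fin: "AE x in M. ?a x * ?b x < \<infinity>"
    by eventually_elim (erule order.strict_trans1, simp)
  then have fin': "AE x in M. ?b x * ?a x < \<infinity>"
    by (simp add: mult.commute)
  \<comment> \<open>The cut-off weights define the same operator: \<open>E(u f)\<close> vanishes with \<open>E|u|\<^sup>2\<close>, and \<open>w\<close> vanishes
    with \<open>E|w|\<^sup>2\<close>.\<close>
  define u' where "u' x = (if ?b x = 0 then 0 else u x)" for x
  define w' where "w' x = (if ?a x = 0 then 0 else w x)" for x
  note u' = restricted_second_moment[OF u w fin, folded u'_def[abs_def]]
    and w' = restricted_second_moment[OF w u fin', folded w'_def[abs_def]]
  note [measurable] = cond_L2_measurable[OF u'(2)] cond_L2_measurable[OF w'(2)]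
  have prod: "AE x in M. ennreal (second_moment u' x * second_moment w' x) = ?a x * ?b x"
    using u'(1) w'(1) ennreal_second_moment[OF u'(2)] ennreal_second_moment[OF w'(2)]
    by eventually_elim (auto simp: ennreal_mult)
  have zero: "AE x in M. ?a x = 0 \<longrightarrow> u x = 0" "AE x in M. ?b x = 0 \<longrightarrow> w x = 0"
    using nn_cond_exp_eq_0_imp_zero[of "\<lambda>x. ennreal ((cmod (u x))\<^sup>2)"]
      nn_cond_exp_eq_0_imp_zero[of "\<lambda>x. ennreal ((cmod (w x))\<^sup>2)"]
    by (auto simp: nn_cond_exp_sq_def)
  have q: "AE x in M. CE (\<lambda>y. u' y * w' y) x = ?q x"
  proof (rule complex_cond_exp_cong)
    show "AE x in M. u' x * w' x = u x * w x"
      using zero by eventually_elim (auto simp: u'_def w'_def)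
  qed measurable
  have op: "ae_equal M (?W f) (weighted_cond_op M F w' u' f)" if f: "f \<in> L2_space M" for f
  proof -
    note [measurable] = L2_space_measurable[OF f]
    let ?e = "CE (\<lambda>y. u y * f y)"
    define g h :: "'a \<Rightarrow> complex" where "g x = (if ?b x = 0 then 0 else 1)"
      and "h x = (if ?a x = 0 then 0 else 1)" for x
    have g: "g \<in> borel_measurable F" and h: "h \<in> borel_measurable F"
      unfolding g_def[abs_def] h_def[abs_def] by measurable
    have "(\<lambda>y. u' y * f y) = (\<lambda>y. g y * (u y * f y))"
      by (auto simp: u'_def g_def)
    then have u'f: "AE x in M. CE (\<lambda>y. u' y * f y) x = g x * ?e x"
      using complex_cond_exp_mult[OF g dom[OF f]] by simp
    have "AE x in M. CE (\<lambda>y. h y * (u y * f y)) x = ?e x"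
    proof (rule complex_cond_exp_cong)
      show "AE x in M. h x * (u x * f x) = u x * f x"
        using zero(1) by eventually_elim (auto simp: h_def)
    qed (use measurable_lift[OF h] in measurable)
    with complex_cond_exp_mult[OF h dom[OF f]] have "AE x in M. h x * ?e x = ?e x"
      by eventually_elim simp
    with u'f zero(2) show ?thesis
      unfolding ae_equal_def weighted_cond_op_def
      by eventually_elim (auto simp: w'_def g_def h_def split: if_splits)
  qed
  have "AE x in M. second_moment u' x * second_moment w' x \<le> K"
    using prod K(2)
  proof eventually_elim
    case (elim x)
    show ?case
      using elim(2) unfolding elim(1)[symmetric] using K(1) by (simp only: ennreal_le_iff)
  qed
  from centered_iff[OF u'(2) w'(2) this W op]
  have "L2_centered M ?W \<longleftrightarrow> (AE x in M. CE (\<lambda>y. u' y * w' y) x \<noteq> 0 \<longrightarrow>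
      (cmod (CE (\<lambda>y. u' y * w' y) x))\<^sup>2 = second_moment u' x * second_moment w' x)" .
  also have "\<dots> \<longleftrightarrow> (AE x in M. ennreal ((cmod (?q x))\<^sup>2) = ?a x * ?b x)"
  proof (rule eventually_cong)
    show "AE x in M. (CE (\<lambda>y. u' y * w' y) x \<noteq> 0 \<longrightarrow>
        (cmod (CE (\<lambda>y. u' y * w' y) x))\<^sup>2 = second_moment u' x * second_moment w' x)
      \<longleftrightarrow> ennreal ((cmod (?q x))\<^sup>2) = ?a x * ?b x"
      using q prod supports
    proof eventually_elim
      case (elim x)
      show ?case
        using elim(3) unfolding elim(1) elim(2)[symmetric] by (cases "?q x = 0") (simp_all del: ennreal_mult)
    qed
  qed
  finally show ?thesis
    by (simp add: ae_equal_def)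
qed

end
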